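(* Let $E\subset\mathbb{C}\setminus\{0\}$ with $0\in\overline{E}$, and for $\varepsilon\in E$ let $S_\varepsilon=\{a_1^\varepsilon,a_2^\varepsilon,a_3^\varepsilon\}\subset\mathbb{D}^2$ with $$a_1^\varepsilon=(0,0),\quad a_2^\varepsilon=(\varepsilon,0),\quad a_3^\varepsilon=(\rho(\varepsilon),\delta(\varepsilon)\rho(\varepsilon)),\qquad \rho(\varepsilon)\ne0,$$ be three distinct points such that $\|a_3^\varepsilon\|\le\|a_3^\varepsilon-a_2^\varepsilon\|\le|\varepsilon|$, $\delta(\varepsilon)\to0$ and $\left|\dfrac{\delta(\varepsilon)}{\varepsilon}\right|\to\infty$ as $\varepsilon\to0$. Let $G_\varepsilon$ be the pluricomplex Green function of $\mathbb{D}^2$ with poles $S_\varepsilon$. Assume that $\dfrac{\log|\delta(\varepsilon)|}{\log|\varepsilon|}\to0$ as $\varepsilon\to0$. If $z=(z_1,z_2)\in\mathbb{D}^2\setminus\{(0,0)\}$ satisfies $|z_2|\ge|z_1|$, then $$\lim_{\varepsilon\to0}G_\varepsilon(z)=\tfrac32\log|z_2|.$$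
   Context: $\mathbb{D}$ is the open unit disk in $\mathbb{C}$ and $\|\cdot\|$ the Euclidean norm on $\mathbb{C}^2$. $PSH_-(\mathbb{D}^2)$ is the set of nonpositive plurisubharmonic functions on $\mathbb{D}^2$. For a finite set $S\subset\mathbb{D}^2$, the pluricomplex Green function with (logarithmic) poles $S$ is $$G_S(z)=\sup\{u(z):\ u\in PSH_-(\mathbb{D}^2),\ u(w)\le\log\|w-a\|+O(1)\text{ as }w\to a,\ \text{for every } a\in S\};$$ this coincides with the Green function of the ideal of holomorphic functions vanishing on $S$. $G_\varepsilon:=G_{S_\varepsilon}$. *)

theory Defs
  imports "HOL-Analysis.Analysis"
begin

text \<open>Functions with values in \<open>[-\<infinity>, \<infinity>)\<close> are total functions into \<^typ>\<open>ereal\<close>; every notion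
  below only looks at their values on the given set.\<close>

definition usc_on :: "'a::topological_space set \<Rightarrow> ('a \<Rightarrow> ereal) \<Rightarrow> bool" where
  "usc_on A u \<longleftrightarrow> (\<forall>x\<in>A. \<forall>c. u x < c \<longrightarrow> (\<forall>\<^sub>F y in at x within A. u y < c))"

text \<open>Mean over the circle of radius \<open>r\<close> about \<open>a\<close>, as an element of \<open>[-\<infinity>, \<infinity>]\<close>. Since
  \<^const>\<open>e2ennreal\<close> truncates negative values to \<open>0\<close>, the two integrals are those of the positive
  and negative parts. For \<open>u\<close> upper semicontinuous with values \<open>< \<infinity>\<close>
  on the circle, the integral of the positive part is finite, so that \<open>\<infinity> - \<infinity>\<close> does not occur.\<close>

definition circle_mean :: "(complex \<Rightarrow> ereal) \<Rightarrow> complex \<Rightarrow> real \<Rightarrow> ereal" where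
  "circle_mean u a r =
     (enn2ereal (\<integral>\<^sup>+ t\<in>{0..2*pi}. e2ennreal (u (a + rcis r t)) \<partial>lborel)
      - enn2ereal (\<integral>\<^sup>+ t\<in>{0..2*pi}. e2ennreal (- u (a + rcis r t)) \<partial>lborel)) / ereal (2*pi)"

text \<open>The constant \<open>-\<infinity>\<close> counts as (pluri)subharmonic.\<close>

definition subharmonic_on :: "complex set \<Rightarrow> (complex \<Rightarrow> ereal) \<Rightarrow> bool" where
  "subharmonic_on A u \<longleftrightarrow>
     (\<forall>x\<in>A. u x < \<infinity>) \<and> usc_on A u \<and>
     (\<forall>a r. 0 < r \<and> cball a r \<subseteq> A \<longrightarrow> u a \<le> circle_mean u a r)"

definition psh_on :: "(complex \<times> complex) set \<Rightarrow> (complex \<times> complex \<Rightarrow> ereal) \<Rightarrow> bool" where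
  "psh_on \<Omega> u \<longleftrightarrow>
     (\<forall>x\<in>\<Omega>. u x < \<infinity>) \<and> usc_on \<Omega> u \<and>
     (\<forall>a1 a2 b1 b2. subharmonic_on {t. (a1 + t * b1, a2 + t * b2) \<in> \<Omega>}
        (\<lambda>t. u (a1 + t * b1, a2 + t * b2)))"

definition psh_nonpos :: "(complex \<times> complex) set \<Rightarrow> (complex \<times> complex \<Rightarrow> ereal) set" where
  "psh_nonpos \<Omega> = {u. psh_on \<Omega> u \<and> (\<forall>x\<in>\<Omega>. u x \<le> 0)}"

text \<open>\<^term>\<open>at a\<close> is the punctured neighbourhood filter, so the junk value \<open>ln 0 = 0\<close> plays no
  role. The norm on pairs is the Euclidean one.\<close>

definition log_pole_at ::
    "complex \<times> complex \<Rightarrow> (complex \<times> complex \<Rightarrow> ereal) \<Rightarrow> bool" where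
  "log_pole_at a u \<longleftrightarrow> (\<exists>C::real. \<forall>\<^sub>F w in at a. u w \<le> ereal (ln (norm (w - a)) + C))"

definition pluricomplex_green ::
    "(complex \<times> complex) set \<Rightarrow> (complex \<times> complex) set \<Rightarrow> complex \<times> complex \<Rightarrow> ereal" where
  "pluricomplex_green \<Omega> S z = (SUP u \<in> {u \<in> psh_nonpos \<Omega>. \<forall>a\<in>S. log_pole_at a u}. u z)"

definition bidisk :: "(complex \<times> complex) set" where
  "bidisk = ball 0 1 \<times> ball 0 1"

end

theory Submission
  imports Defs "HOL-Complex_Analysis.Complex_Analysis"
begin

text \<open>
  Upper and lower bounds for \<open>G\<^sub>\<epsilon>(z)\<close> meet at \<open>3/2 log |z\<^sub>2|\<close>.

  \<^bold>\<open>Lower bound.\<close> Each of the three poles lies on two of the three lines through pairs of poles: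
  \<open>z\<^sub>2 = 0\<close>, \<open>z\<^sub>2 = \<delta> z\<^sub>1\<close> and \<open>z\<^sub>2 = \<sigma> (z\<^sub>1 - \<epsilon>)\<close> with \<open>\<sigma> = \<delta>\<rho> / (\<rho> - \<epsilon>)\<close>. Half the sum of the
  logarithms of the three affine forms, each divided by a bound for its modulus on the bidisk, is
  therefore a competitor in the definition of the Green function. Since \<open>\<delta>\<close> and \<open>\<sigma>\<close> tend to \<open>0\<close>, all
  three lines tend to \<open>z\<^sub>2 = 0\<close> and the competitor tends to \<open>3/2 log |z\<^sub>2|\<close>
  (\<open>three_poles_green_liminf\<close>).

  \<^bold>\<open>Upper bound.\<close> For small \<open>\<epsilon>\<close> there is an analytic disk through \<open>z\<close> and the three poles that
  is close to \<open>x \<mapsto> ((z\<^sub>1/z\<^sub>2) x\<^sup>2, x\<^sup>2)\<close>; on a radius slightly below \<open>1\<close> it stays in the bidisk because \<open>|z\<^sub>1| \<le> |z\<^sub>2|\<close>. It passes through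
  \<open>z\<close> at a parameter \<open>x\<^sub>0\<close> with \<open>x\<^sub>0\<^sup>2 = z\<^sub>2\<close>, and through the poles at three parameters tending to \<open>0\<close>.
  A competitor restricted to this disk is subharmonic with three logarithmic poles near the origin, so
  at \<open>x\<^sub>0\<close> it is at most about \<open>3 log |x\<^sub>0| = 3/2 log |z\<^sub>2|\<close> (\<open>three_poles_green_limsup\<close>).

  Plurisubharmonicity is defined here by complex lines alone, whereas the upper bound restricts a
  competitor to a curve. Instead of regularising the competitor, the maximum principle on a graph
  \<open>y = p x\<close> is proved directly (\<open>psh_graph_maximum_principle\<close>): one maximises over a tube about the
  graph with a penalty \<open>n |y - p x|\<^sup>2\<close>, and tests the mean value inequality at the maximum on the complex
  line of slope \<open>p' x\<close>. On small circles of radius \<open>s\<close> in this line the mean of the penalty changes by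
  \<open>o(s\<^sup>2)\<close> only, which a small strictly subharmonic term absorbs.
\<close>

section \<open>Circle means and upper semicontinuity\<close>

text \<open>Cauchy's integral formula at the centre, on the parametrisation that circle means use.\<close>

lemma integral_circle_holomorphic:
  fixes f :: "complex \<Rightarrow> complex"
  assumes r: "r > 0" and c: "continuous_on (cball a r) f" and h: "f holomorphic_on ball a r"
  shows "((\<lambda>t. f (a + rcis r t)) has_integral 2 * pi * f a) {0..2*pi}"
proof -
  have "((\<lambda>u. f u / (u - a)) has_contour_integral (2 * of_real pi * \<i> * f a)) (circlepath a r)"
    using Cauchy_integral_circlepath[OF c h, of a] r by simp
  then have "((\<lambda>t. f (a + r * cis t) / (r * cis t) * r * \<i> * cis t) has_integral 2 * of_real pi * \<i> * f a) {0..2*pi}"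
    unfolding circlepath_def
    by (subst (asm) has_contour_integral_part_circlepath_iff) auto
  then have "((\<lambda>t. \<i> * f (a + r * cis t)) has_integral 2 * of_real pi * \<i> * f a) {0..2*pi}"
    using r by (simp add: field_simps)
  then have "((\<lambda>t. - \<i> * (\<i> * f (a + r * cis t))) has_integral - \<i> * (2 * of_real pi * \<i> * f a)) {0..2*pi}"
    by (rule has_integral_mult_right)
  then show ?thesis by (simp add: rcis_def algebra_simps)
qed

text \<open>Both integrals that make up the mean are monotone, and for the harmonic majorant \<open>Re K\<close> their
  difference is finite and given by Cauchy's formula.\<close>

lemma circle_mean_le_harmonic:
  fixes K :: "complex \<Rightarrow> complex"
  assumes r: "r > 0" and c: "continuous_on (cball a r) K" and h: "K holomorphic_on ball a r"
    and le: "\<And>x. x \<in> sphere a r \<Longrightarrow> u x \<le> ereal (Re (K x))"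
  shows "circle_mean u a r \<le> ereal (Re (K a))"
proof -
  define g where "g t = Re (K (a + rcis r t))" for t
  have on: "a + rcis r t \<in> sphere a r" for t
    using r by (simp add: dist_norm rcis_def norm_mult)
  have gc: "continuous_on {0..2*pi} g"
    unfolding g_def rcis_def cis_conv_exp
    by (intro continuous_intros continuous_on_compose2[OF c])
       (use r in \<open>auto simp: dist_norm norm_mult\<close>)
  have "(g has_integral Re (2 * pi * K a)) {0..2*pi}"
    using has_integral_Re[OF integral_circle_holomorphic[OF r c h]] unfolding g_def .
  then have gi: "(g has_integral 2 * pi * Re (K a)) {0..2*pi}" by simp
  have si: "set_integrable lborel {0..2*pi} g"
    using borel_integrable_atLeastAtMost'[OF gc] .
  define k where "k t = indicator {0..2*pi} t * g t" for t
  have ki: "integrable lborel k"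
    using si unfolding set_integrable_def k_def by simp
  have keq: "integral\<^sup>L lborel k = 2 * pi * Re (K a)"
    using set_borel_integral_eq_integral(2)[OF si] gi
    unfolding set_lebesgue_integral_def k_def by (simp add: integral_unique)
  define P where "P = (\<integral>\<^sup>+t. ennreal (k t) \<partial>lborel)"
  define N where "N = (\<integral>\<^sup>+t. ennreal (- k t) \<partial>lborel)"
  have fin: "P \<noteq> \<infinity>" "N \<noteq> \<infinity>"
    using ki unfolding real_integrable_def P_def N_def by auto
  have PN: "enn2real P - enn2real N = 2 * pi * Re (K a)"
    using real_lebesgue_integral_def[OF ki] keq unfolding P_def N_def by simp
  have p: "(\<integral>\<^sup>+ t\<in>{0..2*pi}. e2ennreal (u (a + rcis r t)) \<partial>lborel) \<le> P"
    unfolding P_def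
  proof (intro nn_integral_mono)
    fix t
    have "e2ennreal (u (a + rcis r t)) \<le> ennreal (g t)"
      using e2ennreal_mono[OF le[OF on[of t]]] by (simp add: g_def)
    then show "e2ennreal (u (a + rcis r t)) * indicator {0..2*pi} t \<le> ennreal (k t)"
      by (auto simp: k_def indicator_def)
  qed
  have n: "N \<le> (\<integral>\<^sup>+ t\<in>{0..2*pi}. e2ennreal (- u (a + rcis r t)) \<partial>lborel)"
    unfolding N_def
  proof (intro nn_integral_mono)
    fix t
    have "- ereal (g t) \<le> - u (a + rcis r t)"
      using le[OF on[of t]] by (simp add: g_def ereal_minus_le_minus del: uminus_ereal.simps)
    from e2ennreal_mono[OF this] have "ennreal (- g t) \<le> e2ennreal (- u (a + rcis r t))" by simp
    then show "ennreal (- k t) \<le> e2ennreal (- u (a + rcis r t)) * indicator {0..2*pi} t"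
      by (auto simp: k_def indicator_def)
  qed
  have "circle_mean u a r \<le> (enn2ereal P - enn2ereal N) / ereal (2*pi)"
    unfolding circle_mean_def
    by (intro ereal_divide_right_mono ereal_minus_mono) (use p n in \<open>auto simp: less_eq_ennreal.rep_eq\<close>)
  also have "enn2ereal P - enn2ereal N = ereal (2 * pi * Re (K a))"
    using fin PN by (cases P; cases N) (auto simp: enn2ereal_ennreal)
  also have "ereal (2 * pi * Re (K a)) / ereal (2*pi) = ereal (Re (K a))" by simp
  finally show ?thesis .
qed

lemma usc_on_subset: "usc_on A u \<Longrightarrow> B \<subseteq> A \<Longrightarrow> usc_on B u"
  unfolding usc_on_def by (meson filter_leD at_le subsetD)

lemma usc_on_compose:
  assumes u: "usc_on B u" and h: "continuous_on A h" "h ` A \<subseteq> B"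
  shows "usc_on A (\<lambda>x. u (h x))"
  unfolding usc_on_def
proof (intro ballI allI impI)
  fix x c assume x: "x \<in> A" and c: "u (h x) < c"
  have "\<forall>\<^sub>F y in nhds (h x). y \<noteq> h x \<longrightarrow> y \<in> B \<longrightarrow> u y < c"
    using u h(2) x c unfolding usc_on_def eventually_at_filter by blast
  then have "\<forall>\<^sub>F y in nhds (h x). y \<in> B \<longrightarrow> u y < c"
    by eventually_elim (use c in auto)
  moreover have "filterlim h (nhds (h x)) (at x within A)"
    using h(1) x unfolding continuous_on_def by blast
  ultimately have "\<forall>\<^sub>F y in at x within A. h y \<in> B \<longrightarrow> u (h y) < c"
    by (rule eventually_compose_filterlim)
  moreover have "\<forall>\<^sub>F y in at x within A. y \<in> A"
    by (simp add: eventually_at_filter)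
  ultimately show "\<forall>\<^sub>F y in at x within A. u (h y) < c"
    by eventually_elim (use h(2) in auto)
qed

lemma usc_on_add_continuous:
  assumes u: "usc_on A u" and g: "continuous_on A g"
  shows "usc_on A (\<lambda>x. u x + ereal (g x))"
  unfolding usc_on_def
proof (intro ballI allI impI)
  fix x c assume x: "x \<in> A" and c: "u x + ereal (g x) < c"
  obtain d where d: "u x < ereal d" "ereal (d + g x) < c"
  proof -
    from c have "u x < c - ereal (g x)"
      by (simp add: ereal_less_minus_iff)
    then obtain d where "u x < ereal d" "ereal d < c - ereal (g x)"
      by (meson ereal_dense2)
    then show ?thesis using that[of d] by (simp add: ereal_less_minus_iff)
  qed
  have "((\<lambda>y. d + g y) \<longlongrightarrow> d + g x) (at x within A)"
    using g x unfolding continuous_on_def by (intro tendsto_intros) auto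
  then have "((\<lambda>y. ereal (d + g y)) \<longlongrightarrow> ereal (d + g x)) (at x within A)"
    by (rule tendsto_ereal)
  then have "\<forall>\<^sub>F y in at x within A. ereal (d + g y) < c"
    using d(2) by (rule order_tendstoD)
  moreover have "\<forall>\<^sub>F y in at x within A. u y < ereal d"
    using u x d(1) unfolding usc_on_def by blast
  ultimately show "\<forall>\<^sub>F y in at x within A. u y + ereal (g y) < c"
  proof eventually_elim
    case (elim y)
    have "u y + ereal (g y) \<le> ereal d + ereal (g y)"
      using elim(2) by (intro add_right_mono) auto
    then show ?case using elim(1) by (simp add: le_less_trans)
  qed
qed

lemma openin_usc_sublevel:
  assumes "usc_on A u"
  shows "openin (top_of_set A) {x \<in> A. u x < c}"
proof (subst openin_subopen, intro ballI)
  fix x assume x: "x \<in> {x \<in> A. u x < c}"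
  then have "\<forall>\<^sub>F y in at x within A. u y < c"
    using assms unfolding usc_on_def by blast
  then obtain U where U: "open U" "x \<in> U" "\<And>y. y \<in> U \<Longrightarrow> y \<noteq> x \<Longrightarrow> y \<in> A \<Longrightarrow> u y < c"
    unfolding eventually_at_topological by blast
  show "\<exists>T. openin (top_of_set A) T \<and> x \<in> T \<and> T \<subseteq> {x \<in> A. u x < c}"
    using U x by (intro exI[of _ "A \<inter> U"]) (auto simp: openin_open_Int)
qed

lemma compact_usc_superlevel:
  assumes "compact K" "usc_on K u"
  shows "compact {x \<in> K. c \<le> u x}"
proof -
  have "{x \<in> K. c \<le> u x} = K - {x \<in> K. u x < c}" by auto
  moreover have "closedin (top_of_set K) (K - {x \<in> K. u x < c})"
    using openin_usc_sublevel[OF assms(2)] by (intro closedin_diff) auto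
  ultimately show ?thesis
    using assms(1) closedin_compact by metis
qed

text \<open>The superlevel sets \<open>{y. u x \<le> u y}\<close> for \<open>x \<in> K\<close> are compact, and finitely many of them
  intersect in the one with the largest \<open>u x\<close>; a point common to all of them is a maximum.\<close>

lemma usc_on_compact_attains_sup:
  fixes u :: "'a::t2_space \<Rightarrow> ereal"
  assumes K: "compact K" "K \<noteq> {}" and u: "usc_on K u"
  shows "\<exists>x\<in>K. \<forall>y\<in>K. u y \<le> u x"
proof -
  have "K \<inter> (\<Inter>x\<in>K. {y \<in> K. u x \<le> u y}) \<noteq> {}"
  proof (rule compact_imp_fip_image[OF K(1)])
    show "closed {y \<in> K. u x \<le> u y}" for x
      using compact_usc_superlevel[OF K(1) u] by (rule compact_imp_closed)
    fix I assume I: "finite I" "I \<subseteq> K"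
    show "K \<inter> (\<Inter>x\<in>I. {y \<in> K. u x \<le> u y}) \<noteq> {}"
    proof (cases "I = {}")
      case False
      then have "Max (u ` I) \<in> u ` I" using I by (intro Max_in) auto
      then obtain k where k: "k \<in> I" "Max (u ` I) = u k" by auto
      then have "u x \<le> u k" if "x \<in> I" for x
        using Max_ge[of "u ` I" "u x"] I that by simp
      then show ?thesis using k I by blast
    qed (use K in auto)
  qed
  then show ?thesis by auto
qed

section \<open>The maximum principle on a graph\<close>

text \<open>The maximum principle for \<open>v (x, p x) - \<psi> x\<close>, where \<open>\<psi>\<close> is harmonic. Suppose it fails by a positive
  margin. On the tube \<open>y = p x + w\<close>, \<open>|w| \<le> \<theta>\<close>, consider
  \<open>F n (x, w) = v (x, p x + w) - \<psi> x + \<eta> |x|\<^sup>2 - n |w|\<^sup>2\<close>. For \<open>n\<close> large this upper semicontinuous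
  function attains its maximum \<open>F n (xs, ws)\<close> off the boundary of the tube. Along the line
  \<open>t \<mapsto> (xs + t, ys + t p'(xs))\<close> one has \<open>w = ws - e t\<close> with \<open>e\<close> holomorphic and \<open>e t = o(t)\<close>, hence
  \<open>|w|\<^sup>2 = |ws|\<^sup>2 - 2 Re (cnj ws e t) + o(|t|\<^sup>2)\<close>, where the middle term is harmonic. Thus on the circle
  \<open>|t| = s\<close> the maximality of \<open>F n (xs, ws)\<close> bounds \<open>v\<close> by a harmonic function whose value at the centre
  is \<open>v (xs, ys) - \<eta> s\<^sup>2 + o(s\<^sup>2)\<close>, against the mean value inequality.\<close>

lemma psh_graph_maximum_principle:
  fixes v :: "complex \<times> complex \<Rightarrow> ereal" and p :: "complex \<Rightarrow> complex" and \<psi> :: "complex \<Rightarrow> real"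
  assumes psh: "psh_on \<Omega> v" and \<Omega>: "open \<Omega>"
    and Z: "compact Z" and U: "open U" "U \<subseteq> Z"
    and p: "continuous_on Z p" "p holomorphic_on U"
    and graph: "\<And>x. x \<in> Z \<Longrightarrow> (x, p x) \<in> \<Omega>"
    and \<psi>: "continuous_on Z \<psi>"
    and harmonic: "\<And>x. x \<in> U \<Longrightarrow> \<exists>s>0. \<exists>H. H holomorphic_on ball x s \<and> (\<forall>y\<in>ball x s. \<psi> y = Re (H y))"
    and bd: "\<And>x. x \<in> Z - U \<Longrightarrow> v (x, p x) \<le> ereal (\<psi> x)"
    and x0: "x0 \<in> U"
  shows "v (x0, p x0) \<le> ereal (\<psi> x0)"
proof (rule ccontr)
  assume "\<not> ?thesis"
  then have less: "ereal (\<psi> x0) < v (x0, p x0)" by simp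
  have x0Z: "x0 \<in> Z" using x0 U by auto
  have "v (x0, p x0) < \<infinity>" using psh graph[OF x0Z] unfolding psh_on_def by auto
  with less obtain V0 where V0: "v (x0, p x0) = ereal V0" "\<psi> x0 < V0"
    by (cases "v (x0, p x0)") auto
  obtain D where D: "\<And>x. x \<in> Z \<Longrightarrow> norm x \<le> D"
    using compact_imp_bounded[OF Z] unfolding bounded_iff by blast
  define m where "m = (V0 - \<psi> x0) / 2"
  define \<eta> where "\<eta> = m / (2 * (D\<^sup>2 + 1))"
  have m: "m > 0" using V0 by (simp add: m_def)
  have D1: "D\<^sup>2 + 1 > 0" by (smt (verit) zero_le_power2)
  have \<eta>: "\<eta> > 0" using m D1 by (simp add: \<eta>_def)
  have \<eta>D: "\<eta> * (norm x)\<^sup>2 < m" if "x \<in> Z" for x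
  proof -
    have "(norm x)\<^sup>2 \<le> D\<^sup>2" using D[OF that] by (intro power_mono) auto
    then have "\<eta> * (norm x)\<^sup>2 \<le> \<eta> * (D\<^sup>2 + 1)" using \<eta> by (intro mult_left_mono) auto
    also have "\<dots> = m / 2" using D1 unfolding \<eta>_def by (simp add: field_simps add_nonneg_eq_0_iff)
    finally show ?thesis using m by simp
  qed
  \<comment> \<open>The coordinates \<open>(x, w)\<close> with \<open>y = p x + w\<close> straighten the tube about the graph to a product.\<close>
  have "compact ((\<lambda>x. (x, p x)) ` Z)"
    using Z p(1) by (intro compact_continuous_image continuous_intros)
  moreover have "(\<lambda>x. (x, p x)) ` Z \<subseteq> \<Omega>" using graph by auto
  ultimately obtain \<theta> where \<theta>: "\<theta> > 0" and tube: "(\<Union>q\<in>(\<lambda>x. (x, p x)) ` Z. cball q \<theta>) \<subseteq> \<Omega>"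
    using compact_subset_open_imp_cball_epsilon_subset[OF _ \<Omega>] by metis
  define T where "T = Z \<times> cball (0::complex) \<theta>"
  define h where "h X = (fst X, p (fst X) + snd X)" for X :: "complex \<times> complex"
  have T: "compact T" "T \<noteq> {}" using Z x0Z \<theta> by (auto simp: T_def intro: compact_Times)
  have hT: "h ` T \<subseteq> \<Omega>"
  proof (rule image_subsetI)
    fix X assume "X \<in> T"
    then have "h X \<in> cball (fst X, p (fst X)) \<theta>" "fst X \<in> Z"
      by (auto simp: h_def T_def dist_norm norm_Pair)
    then show "h X \<in> \<Omega>" using tube by blast
  qed
  have cont: "continuous_on T (\<lambda>X. p (fst X))" "continuous_on T (\<lambda>X. \<psi> (fst X))"
    by (auto simp: T_def intro!: continuous_on_compose2[OF p(1)] continuous_on_compose2[OF \<psi>] continuous_intros)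
  have uscT: "usc_on T (\<lambda>X. v (h X))"
  proof (rule usc_on_compose[OF _ _ hT])
    show "usc_on \<Omega> v" using psh unfolding psh_on_def by blast
    show "continuous_on T h" unfolding h_def using cont by (intro continuous_intros)
  qed
  define F where "F n X = v (h X) + ereal (\<eta> * (norm (fst X))\<^sup>2 - \<psi> (fst X) - n * (norm (snd X))\<^sup>2)"
    for n :: real and X
  have uscF: "usc_on T (F n)" for n
    unfolding F_def using cont by (intro usc_on_add_continuous[OF uscT] continuous_intros)
  \<comment> \<open>On the boundary of the tube, \<open>F 0 \<ge> m\<close> can only happen off the graph, where by compactness
    \<open>|w| \<ge> \<kappa>\<close>; a large penalty then pushes the values below \<open>m\<close>.\<close>
  define Bd where "Bd = (Z - U) \<times> cball (0::complex) \<theta> \<union> Z \<times> sphere 0 \<theta>"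
  have Bd: "compact Bd" "Bd \<subseteq> T"
    unfolding Bd_def T_def using Z U(1) by (auto intro!: compact_Un compact_Times compact_diff)
  define Bm where "Bm = {X \<in> Bd. ereal m \<le> F 0 X}"
  have Bm: "compact Bm"
    unfolding Bm_def by (rule compact_usc_superlevel[OF Bd(1) usc_on_subset[OF uscF Bd(2)]])
  have nz: "snd X \<noteq> 0" if "X \<in> Bm" for X
  proof
    assume 0: "snd X = 0"
    have X: "X \<in> Bd" "ereal m \<le> F 0 X" using that unfolding Bm_def by auto
    then have x: "fst X \<in> Z - U" using 0 \<theta> by (auto simp: Bd_def)
    have "F 0 X = v (fst X, p (fst X)) + ereal (\<eta> * (norm (fst X))\<^sup>2 - \<psi> (fst X))"
      by (simp add: F_def h_def 0)
    also have "\<dots> \<le> ereal (\<psi> (fst X)) + ereal (\<eta> * (norm (fst X))\<^sup>2 - \<psi> (fst X))"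
      using bd[OF x] by (intro add_right_mono)
    also have "\<dots> < ereal m" using \<eta>D x by simp
    finally show False using X by simp
  qed
  obtain \<kappa> where \<kappa>: "\<kappa> > 0" "\<And>X. X \<in> Bm \<Longrightarrow> \<kappa> \<le> norm (snd X)"
  proof (cases "Bm = {}")
    case True then show ?thesis using that[of 1] by auto
  next
    case False
    have "continuous_on Bm (\<lambda>X. norm (snd X))" by (intro continuous_intros)
    from continuous_attains_inf[OF Bm False this] obtain X where "X \<in> Bm" "\<forall>Y\<in>Bm. norm (snd X) \<le> norm (snd Y)"
      by blast
    then show ?thesis using that[of "norm (snd X)"] nz by auto
  qed
  obtain M :: real where M: "\<And>X. X \<in> T \<Longrightarrow> F 0 X \<le> ereal M"
  proof -
    obtain X where X: "X \<in> T" "\<forall>Y\<in>T. F 0 Y \<le> F 0 X"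
      using usc_on_compact_attains_sup[OF T uscF] by blast
    have "v (h X) < \<infinity>" using psh hT X(1) unfolding psh_on_def by blast
    then have "F 0 X \<noteq> \<infinity>" unfolding F_def by auto
    then obtain k where "F 0 X < ereal (real k)" using less_PInf_Ex_of_nat by auto
    then show ?thesis using that[of "real k"] X(2) by (meson less_imp_le order_trans)
  qed
  define n where "n = (\<bar>M\<bar> + \<bar>m\<bar> + 1) / \<kappa>\<^sup>2"
  have n: "n > 0" using \<kappa> by (auto simp: n_def intro!: divide_pos_pos)
  have n\<kappa>: "M - n * \<kappa>\<^sup>2 < m" using \<kappa> by (simp add: n_def)
  obtain X where X: "X \<in> T" "\<And>Y. Y \<in> T \<Longrightarrow> F n Y \<le> F n X"
    using usc_on_compact_attains_sup[OF T uscF] by blast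
  have "ereal m < F n (x0, 0)"
  proof -
    have "F n (x0, 0) = ereal (V0 + (\<eta> * (norm x0)\<^sup>2 - \<psi> x0))"
      by (simp add: F_def h_def V0)
    moreover have "\<eta> * (norm x0)\<^sup>2 \<ge> 0" using \<eta> by simp
    ultimately show ?thesis using m by (simp add: m_def)
  qed
  moreover have "(x0, 0) \<in> T" using x0Z \<theta> by (simp add: T_def)
  ultimately have mX: "ereal m < F n X" using X(2) less_le_trans by blast
  obtain xs ws where Xs: "X = (xs, ws)" by (cases X)
  define ys where "ys = p xs + ws"
  have hX: "h X = (xs, ys)" by (simp add: h_def Xs ys_def)
  have "v (h X) < \<infinity>" using psh hT X(1) unfolding psh_on_def by blast
  moreover have "v (h X) \<noteq> -\<infinity>" using mX by (auto simp: F_def)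
  ultimately obtain V where V: "v (xs, ys) = ereal V" unfolding hX by (cases "v (xs, ys)") auto
  have FX: "F k X = ereal (V + (\<eta> * (norm xs)\<^sup>2 - \<psi> xs - k * (norm ws)\<^sup>2))" for k
    unfolding F_def hX V by (simp add: Xs)
  have "X \<notin> Bd"
  proof
    assume "X \<in> Bd"
    show False
    proof (cases "X \<in> Bm")
      case True
      have "V + (\<eta> * (norm xs)\<^sup>2 - \<psi> xs) \<le> M" using M[OF X(1)] FX[of 0] by simp
      moreover have "n * \<kappa>\<^sup>2 \<le> n * (norm ws)\<^sup>2"
        using \<kappa>(2)[OF True] \<kappa>(1) n Xs by (intro mult_left_mono power_mono) auto
      ultimately show False using n\<kappa> mX FX[of n] by simp
    next
      case False
      then have "F 0 X < ereal m" using \<open>X \<in> Bd\<close> by (auto simp: Bm_def)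
      then have "V + (\<eta> * (norm xs)\<^sup>2 - \<psi> xs) < m" using FX[of 0] by simp
      moreover have "0 \<le> n * (norm ws)\<^sup>2" using n by simp
      ultimately show False using mX FX[of n] by simp
    qed
  qed
  then have xs: "xs \<in> U" and ws: "norm ws < \<theta>"
    using X(1) by (auto simp: Bd_def T_def Xs)
  \<comment> \<open>The constant \<open>k\<close> below is such that \<open>|e t| \<le> k |t|\<close> costs the penalty at most half of the gain
    \<open>\<eta> |t|\<^sup>2\<close>.\<close>
  define e where "e t = p (xs + t) - p xs - deriv p xs * t" for t
  obtain s0 H where s0: "s0 > 0" and H: "H holomorphic_on ball xs s0" "\<And>y. y \<in> ball xs s0 \<Longrightarrow> \<psi> y = Re (H y)"
    using harmonic[OF xs] by blast
  define k where "k = sqrt (\<eta> / (2 * n))"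
  have k: "k > 0" "n * k\<^sup>2 = \<eta> / 2" using \<eta> n by (auto simp: k_def)
  have dp: "(p has_field_derivative deriv p xs) (at xs)"
    using holomorphic_derivI[OF p(2) U(1) xs] .
  obtain d1 where d1: "d1 > 0" "\<And>t. norm t < d1 \<Longrightarrow> norm (e t) \<le> k * norm t"
  proof -
    from dp k(1) obtain d where d: "d > 0"
      "\<forall>y. norm (y - xs) < d \<longrightarrow> norm (p y - p xs - deriv p xs * (y - xs)) \<le> k * norm (y - xs)"
      unfolding has_field_derivative_def has_derivative_at_alt by blast
    have "norm (e t) \<le> k * norm t" if "norm t < d" for t
      using d(2)[rule_format, of "xs + t"] that by (simp add: e_def)
    then show ?thesis using that[of d] d(1) by blast
  qed
  have "\<forall>\<^sub>F t in nhds 0. xs + t \<in> U"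
    using U(1) xs by (intro eventually_compose_filterlim[OF eventually_nhds_in_open[of U xs]]) (auto intro!: tendsto_eq_intros simp: filterlim_ident)
  moreover have "\<forall>\<^sub>F t in nhds 0. norm (ws - e t) < \<theta>"
  proof -
    have "isCont p xs" using dp by (rule DERIV_isCont)
    then have "isCont (\<lambda>t. p (xs + t)) 0" 
      using isCont_o2[where f = "\<lambda>t. xs + t" and g = p and a = 0] by simp
    then have "isCont (\<lambda>t. norm (ws - e t)) 0"
      unfolding e_def by (intro continuous_intros)
    then have "((\<lambda>t. norm (ws - e t)) \<longlongrightarrow> norm (ws - e 0)) (nhds 0)"
      unfolding continuous_at
      by (subst tendsto_at_iff_tendsto_nhds[symmetric, where g = "\<lambda>t. norm (ws - e t)"])
    moreover have "norm (ws - e 0) < \<theta>" using ws by (simp add: e_def)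
    ultimately show ?thesis by (rule order_tendstoD)
  qed
  ultimately have "\<forall>\<^sub>F t in nhds 0. xs + t \<in> U \<and> norm (ws - e t) < \<theta>"
    by (rule eventually_conj)
  then obtain d2 where d2: "d2 > 0" "\<And>t. norm t < d2 \<Longrightarrow> xs + t \<in> U \<and> norm (ws - e t) < \<theta>"
    unfolding eventually_nhds_metric by (auto simp: dist_norm)
  define d where "d = min s0 (min d1 d2)"
  define s where "s = d / 2"
  have d: "d > 0" "s > 0" "s < d" using s0 d1 d2 by (auto simp: d_def s_def)
  \<comment> \<open>\<open>Re (K t)\<close> is the harmonic majorant on \<open>|t| = s\<close>; the constant subtracted last
    is a lower bound for \<open>\<eta> |t|\<^sup>2 - n |e t|\<^sup>2\<close> on that circle.\<close>
  define K where "K t = of_real V + (H (xs + t) - H xs) - 2 * \<eta> * cnj xs * t - 2 * n * cnj ws * e t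
     - of_real (\<eta> * s\<^sup>2 - \<eta> / 2 * s\<^sup>2)" for t
  have holK: "K holomorphic_on ball 0 d"
  proof -
    have 1: "(\<lambda>t. H (xs + t)) holomorphic_on ball 0 d"
      by (rule holomorphic_on_compose_gen[OF _ H(1), unfolded o_def])
         (auto simp: d_def dist_norm intro!: holomorphic_intros)
    have sub: "(\<lambda>t. xs + t) ` ball 0 d \<subseteq> U"
      by (intro image_subsetI) (simp add: d2(2) d_def)
    have 2: "(\<lambda>t. p (xs + t)) holomorphic_on ball 0 d"
      by (rule holomorphic_on_compose_gen[OF _ p(2), unfolded o_def])
         (use sub in \<open>auto intro!: holomorphic_intros\<close>)
    show ?thesis unfolding K_def e_def by (intro holomorphic_intros 1 2)
  qed
  have inT: "(xs + t, ws - e t) \<in> T" if "norm t < d" for t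
    using d2(2)[of t] U(2) that by (auto simp: T_def d_def)
  have h_line: "h (xs + t, ws - e t) = (xs + t, ys + t * deriv p xs)" for t
    by (simp add: h_def e_def ys_def algebra_simps)
  define L where "L t = v (xs + t * 1, ys + t * deriv p xs)" for t
  have le: "L t \<le> ereal (Re (K t))" if t: "t \<in> sphere 0 s" for t
  proof -
    have nt: "norm t = s" "norm t < d" using t d by auto
    have psi: "\<psi> (xs + t) = Re (H (xs + t))" "\<psi> xs = Re (H xs)"
      using nt s0 by (auto intro!: H(2) simp: d_def dist_norm)
    define W where "W = V + (\<psi> (xs + t) - \<psi> xs) - \<eta> * ((norm (xs + t))\<^sup>2 - (norm xs)\<^sup>2)
      + n * ((norm (ws - e t))\<^sup>2 - (norm ws)\<^sup>2)"
    have "F n (xs + t, ws - e t) \<le> F n X" using X(2) inT[OF nt(2)] .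
    then have "L t + ereal (\<eta> * (norm (xs + t))\<^sup>2 - \<psi> (xs + t) - n * (norm (ws - e t))\<^sup>2)
        \<le> ereal (V + (\<eta> * (norm xs)\<^sup>2 - \<psi> xs - n * (norm ws)\<^sup>2))"
      unfolding FX by (simp add: F_def h_line L_def)
    then have "L t \<le> ereal W"
      unfolding W_def by (cases "L t") (auto simp: algebra_simps)
    also have "W \<le> Re (K t)"
    proof -
      have 1: "(norm (xs + t))\<^sup>2 - (norm xs)\<^sup>2 = 2 * Re (cnj xs * t) + s\<^sup>2"
        unfolding nt(1)[symmetric] cmod_power2
        by (simp add: power2_eq_square algebra_simps)
      have 2: "(norm (ws - e t))\<^sup>2 - (norm ws)\<^sup>2 = - 2 * Re (cnj ws * e t) + (norm (e t))\<^sup>2"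
        unfolding cmod_power2 by (simp add: power2_eq_square algebra_simps)
      have "(norm (e t))\<^sup>2 \<le> (k * s)\<^sup>2"
        using d1(2)[of t] nt by (intro power_mono) (auto simp: d_def)
      then have "n * (norm (e t))\<^sup>2 \<le> n * (k * s)\<^sup>2" using n by (intro mult_left_mono) auto
      also have "\<dots> = \<eta> / 2 * s\<^sup>2" using k(2) by (simp add: power_mult_distrib flip: mult.assoc)
      finally have 3: "n * (norm (e t))\<^sup>2 \<le> \<eta> / 2 * s\<^sup>2" .
      have "Re (K t) = V + (\<psi> (xs + t) - \<psi> xs) - 2 * \<eta> * Re (cnj xs * t) - 2 * n * Re (cnj ws * e t)
         - (\<eta> * s\<^sup>2 - \<eta> / 2 * s\<^sup>2)"
        unfolding K_def psi by (simp add: algebra_simps)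
      then show ?thesis unfolding W_def 1 2 using 3 by (simp add: algebra_simps)
    qed
    finally show ?thesis by simp
  qed
  have "circle_mean L 0 s \<le> ereal (Re (K 0))"
  proof (rule circle_mean_le_harmonic[OF d(2) _ _ le])
    have "cball 0 s \<subseteq> ball 0 d" using d by auto
    then show "continuous_on (cball 0 s) K" "K holomorphic_on ball 0 s"
      using holK holomorphic_on_imp_continuous_on holomorphic_on_subset ball_subset_cball
      by (metis order_trans)+
  qed
  moreover have "L 0 \<le> circle_mean L 0 s"
  proof -
    have "subharmonic_on {t. (xs + t * 1, ys + t * deriv p xs) \<in> \<Omega>} L"
      using psh unfolding psh_on_def L_def by blast
    moreover have "cball 0 s \<subseteq> {t. (xs + t * 1, ys + t * deriv p xs) \<in> \<Omega>}"
    proof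
      fix t :: complex assume "t \<in> cball 0 s"
      then have "norm t < d" using d by auto
      from inT[OF this] have "h (xs + t, ws - e t) \<in> \<Omega>" using hT by blast
      then show "t \<in> {t. (xs + t * 1, ys + t * deriv p xs) \<in> \<Omega>}" unfolding h_line by simp
    qed
    ultimately show ?thesis using d(2) unfolding subharmonic_on_def by blast
  qed
  ultimately have "L 0 \<le> ereal (Re (K 0))" by (rule order_trans[rotated])
  then have "ereal V \<le> ereal (Re (K 0))" using V by (simp add: L_def)
  then have "V \<le> V - \<eta> / 2 * s\<^sup>2" by (simp add: K_def e_def)
  then show False using \<eta> d by (simp add: mult_le_0_iff)
qed

section \<open>Logarithmic poles along a graph\<close>

text \<open>A linear map sends complex lines to complex lines or points, which the definition also admits.\<close>

lemma psh_on_linear_preimage: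
  fixes u :: "complex \<times> complex \<Rightarrow> ereal" and A B C D :: complex
  assumes u: "psh_on \<Omega> u"
  defines "L \<equiv> \<lambda>X. (A * fst X + B * snd X, C * fst X + D * snd X)"
  shows "psh_on (L -` \<Omega>) (\<lambda>X. u (L X))"
  unfolding psh_on_def
proof (intro conjI allI)
  show "\<forall>x\<in>L -` \<Omega>. u (L x) < \<infinity>" using u unfolding psh_on_def by auto
  have "usc_on \<Omega> u" using u unfolding psh_on_def by blast
  then show "usc_on (L -` \<Omega>) (\<lambda>X. u (L X))"
    by (rule usc_on_compose) (auto simp: L_def intro!: continuous_intros)
  fix a1 a2 b1 b2
  have line: "L (a1 + t * b1, a2 + t * b2) =
      ((A * a1 + B * a2) + t * (A * b1 + B * b2), (C * a1 + D * a2) + t * (C * b1 + D * b2))" for t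
    by (simp add: L_def algebra_simps)
  show "subharmonic_on {t. (a1 + t * b1, a2 + t * b2) \<in> L -` \<Omega>} (\<lambda>t. u (L (a1 + t * b1, a2 + t * b2)))"
    unfolding vimage_eq line using u unfolding psh_on_def by blast
qed

text \<open>On a disk about \<open>x\<close> that avoids \<open>q\<close>, the quotient \<open>(y - q) / (x - q)\<close> has positive real part, so
  the principal branch of its logarithm is holomorphic.\<close>

lemma sum_ln_norm_eq_Re_holomorphic:
  assumes Q: "finite Q" "Q \<inter> ball x s = {}" and s: "s > 0" and c: "\<And>q. q \<in> Q \<Longrightarrow> c q > 0"
  shows "\<exists>H. H holomorphic_on ball x s \<and> (\<forall>y\<in>ball x s. (\<Sum>q\<in>Q. ln (norm (y - q) / c q)) = Re (H y))"
proof -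
  define H where "H y = (\<Sum>q\<in>Q. of_real (ln (norm (x - q) / c q)) + Ln ((y - q) / (x - q)))" for y
  have nz: "x - q \<noteq> 0" if "q \<in> Q" for q using that Q(2) s by force
  have pos: "0 < Re ((y - q) / (x - q))" if "q \<in> Q" "y \<in> ball x s" for q y
  proof -
    have "norm (x - y) < norm (x - q)"
      using that Q(2) by (force simp: dist_norm)
    then have "norm (1 - (y - q) / (x - q)) < 1"
      using nz[OF that(1)] by (simp add: diff_divide_eq_iff norm_divide)
    then have "Re (1 - (y - q) / (x - q)) < 1"
      using complex_Re_le_cmod le_less_trans by blast
    then show ?thesis by simp
  qed
  have "H holomorphic_on ball x s"
    unfolding H_def
  proof (intro holomorphic_intros)
    fix y q assume "q \<in> Q" "y \<in> ball x s"
    then show "(y - q) / (x - q) \<notin> \<real>\<^sub>\<le>\<^sub>0" using pos[of q y] by (auto elim!: nonpos_Reals_cases)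
  qed (use nz in auto)
  moreover have "(\<Sum>q\<in>Q. ln (norm (y - q) / c q)) = Re (H y)" if y: "y \<in> ball x s" for y
    unfolding H_def Re_sum
  proof (rule sum.cong[OF refl])
    fix q assume q: "q \<in> Q"
    have "(y - q) / (x - q) \<noteq> 0" using pos[OF q y] by force
    then have y0: "y - q \<noteq> 0" by auto
    have "Re (Ln ((y - q) / (x - q))) = ln (norm (y - q)) - ln (norm (x - q))"
      using \<open>(y - q) / (x - q) \<noteq> 0\<close> nz[OF q] y0 by (simp add: norm_divide ln_div)
    then show "ln (norm (y - q) / c q) = Re (of_real (ln (norm (x - q) / c q)) + Ln ((y - q) / (x - q)))"
      using nz[OF q] y0 c[OF q] by (simp add: ln_div)
  qed
  ultimately show ?thesis by blast
qed

lemma filterlim_ln_norm_at_bot: "filterlim (\<lambda>x. ln (norm (x - q :: complex))) at_bot (at q)"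
proof (rule filterlim_compose[OF ln_at_0])
  have "((\<lambda>x. norm (x - q)) \<longlongrightarrow> norm (q - q)) (at q)" by (intro tendsto_intros)
  then show "filterlim (\<lambda>x. norm (x - q)) (at_right 0) (at q)"
    unfolding filterlim_at by (auto simp: eventually_at_filter)
qed

text \<open>A differentiable curve is Lipschitz at \<open>q\<close>, so the logarithmic pole only gets shifted by a constant.
  The curve must not return to the pole: the pole condition is about punctured neighbourhoods.\<close>

lemma log_pole_along_curve:
  fixes \<phi> :: "complex \<Rightarrow> complex \<times> complex"
  assumes u: "log_pole_at (\<phi> q) u" and inj: "\<And>x. x \<noteq> q \<Longrightarrow> \<phi> x \<noteq> \<phi> q"
    and d: "(\<phi> has_derivative D) (at q)"
  shows "\<exists>C. \<forall>\<^sub>F x in at q. u (\<phi> x) \<le> ereal (ln (norm (x - q)) + C)"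
proof -
  obtain C where C: "\<forall>\<^sub>F w in at (\<phi> q). u w \<le> ereal (ln (norm (w - \<phi> q)) + C)"
    using u unfolding log_pole_at_def by blast
  have "(\<phi> \<longlongrightarrow> \<phi> q) (at q)"
    using has_derivative_continuous[OF d] by (simp add: continuous_at)
  then have "filterlim \<phi> (at (\<phi> q)) (at q)"
    unfolding filterlim_at using inj by (auto simp: eventually_at_filter)
  from eventually_compose_filterlim[OF C this]
  have 1: "\<forall>\<^sub>F x in at q. u (\<phi> x) \<le> ereal (ln (norm (\<phi> x - \<phi> q)) + C)" .
  obtain k where k: "\<And>h. norm (D h) \<le> norm h * k"
    using bounded_linear.bounded[OF has_derivative_bounded_linear[OF d]] by blast
  obtain r where r: "r > 0" "\<And>y. norm (y - q) < r \<Longrightarrow> norm (\<phi> y - \<phi> q - D (y - q)) \<le> 1 * norm (y - q)"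
    using d unfolding has_derivative_at_alt by (meson zero_less_one)
  define K where "K = \<bar>k\<bar> + 1"
  have K: "norm (\<phi> y - \<phi> q) \<le> K * norm (y - q)" if "norm (y - q) < r" for y
  proof -
    have "norm (\<phi> y - \<phi> q) \<le> norm (\<phi> y - \<phi> q - D (y - q)) + norm (D (y - q))"
      using norm_triangle_ineq[of "\<phi> y - \<phi> q - D (y - q)" "D (y - q)"] by simp
    also have "\<dots> \<le> norm (y - q) + norm (y - q) * \<bar>k\<bar>"
      using r(2)[OF that] k[of "y - q"] mult_left_mono[OF abs_ge_self norm_ge_zero[of "y - q"], of k] by linarith
    finally show ?thesis by (simp add: K_def algebra_simps)
  qed
  have 2: "\<forall>\<^sub>F x in at q. norm (x - q) < r \<and> x \<noteq> q"
    using r(1) by (auto simp: eventually_at dist_norm)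
  have "\<forall>\<^sub>F x in at q. u (\<phi> x) \<le> ereal (ln (norm (x - q)) + (ln K + C))"
    using 1 2
  proof eventually_elim
    case (elim x)
    have "K > 0" by (simp add: K_def)
    have "ln (norm (\<phi> x - \<phi> q)) \<le> ln (K * norm (x - q))"
      using K[of x] elim(2) inj[of x] by (intro ln_mono) auto
    also have "\<dots> = ln K + ln (norm (x - q))"
      using elim(2) \<open>K > 0\<close> by (simp add: ln_mult)
    finally have "ereal (ln (norm (\<phi> x - \<phi> q)) + C) \<le> ereal (ln (norm (x - q)) + (ln K + C))" by simp
    with elim(1) show ?case by (rule order_trans)
  qed
  then show ?thesis by blast
qed

text \<open>The comparison function \<open>h x = (\<Sum>q\<in>Q. ln (|x - q| / (R - |q|)))\<close> is harmonic off \<open>Q\<close> and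
  nonnegative on the circle \<open>|x| = R\<close>. Near a pole \<open>u\<close> exceeds \<open>h\<close> at most by a constant, which
  \<open>(1 - \<tau>) h\<close> outweighs since \<open>-\<tau> h\<close> tends to \<open>\<infinity>\<close> there. So the maximum principle applies with the
  majorant \<open>(1 - \<tau>) h\<close> on the disk minus small disks about the poles, and then \<open>\<tau>\<close> goes to \<open>0\<close>. The curve
  is a graph after a linear change of coordinates.\<close>

lemma psh_nonpos_log_poles_on_graph:
  fixes u :: "complex \<times> complex \<Rightarrow> ereal" and p :: "complex \<Rightarrow> complex"
  assumes u: "u \<in> psh_nonpos \<Omega>" and \<Omega>: "open \<Omega>" and A: "A \<noteq> 0"
    and p: "continuous_on (cball 0 R) p" "p holomorphic_on ball 0 R"
    and graph: "\<And>x. x \<in> cball 0 R \<Longrightarrow> (A * x + B * p x, p x) \<in> \<Omega>"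
    and Q: "finite Q" "Q \<subseteq> ball 0 R" "\<And>q. q \<in> Q \<Longrightarrow> log_pole_at (A * q + B * p q, p q) u"
    and x0: "x0 \<in> ball 0 R" "x0 \<notin> Q"
  shows "u (A * x0 + B * p x0, p x0) \<le> ereal (\<Sum>q\<in>Q. ln (norm (x0 - q) / (R - norm q)))"
proof -
  define L where "L = (\<lambda>X. (A * fst X + B * snd X, 0 * fst X + 1 * snd X))"
  define v where "v = (\<lambda>X. u (L X))"
  define \<phi> where "\<phi> x = (A * x + B * p x, p x)" for x
  have v: "v (x, p x) = u (\<phi> x)" for x by (simp add: v_def L_def \<phi>_def)
  have psh: "psh_on (L -` \<Omega>) v"
    using u unfolding v_def L_def psh_nonpos_def by (intro psh_on_linear_preimage) auto
  have openL: "open (L -` \<Omega>)"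
    unfolding L_def by (intro open_vimage[OF \<Omega>] continuous_intros)
  define h where "h x = (\<Sum>q\<in>Q. ln (norm (x - q) / (R - norm q)))" for x
  have R: "R - norm q > 0" if "q \<in> Q" for q using Q(2) that by auto
  have inj: "\<phi> x \<noteq> \<phi> q" if "x \<noteq> q" for x q using that A by (auto simp: \<phi>_def)
  have pole: "\<forall>\<^sub>F x in at q. u (\<phi> x) \<le> ereal ((1 - \<tau>) * h x)" if q: "q \<in> Q" and \<tau>: "0 < \<tau>" "\<tau> < 1" for q \<tau>
  proof -
    have "(p has_field_derivative deriv p q) (at q)"
      using q Q(2) by (intro holomorphic_derivI[OF p(2) open_ball]) auto
    then have dp: "(p has_derivative (*) (deriv p q)) (at q)"
      unfolding has_field_derivative_def .
    have "(\<phi> has_derivative (\<lambda>h. (A * h + B * (deriv p q * h), deriv p q * h))) (at q)"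
      unfolding \<phi>_def by (intro has_derivative_Pair has_derivative_add has_derivative_mult_right has_derivative_ident dp)
    then obtain C where C: "\<forall>\<^sub>F x in at q. u (\<phi> x) \<le> ereal (ln (norm (x - q)) + C)"
      using log_pole_along_curve[of \<phi> q u] inj Q(3)[OF q] unfolding \<phi>_def by blast
    define g where "g x = (\<Sum>q'\<in>Q - {q}. ln (norm (x - q') / (R - norm q')))" for x
    have "isCont g q"
      unfolding g_def using R by (intro continuous_intros) (auto simp: less_le)
    then have "\<forall>\<^sub>F x in at q. g q - 1 < g x"
      unfolding continuous_at by (rule order_tendstoD) simp
    moreover have "\<forall>\<^sub>F x in at q. ln (norm (x - q)) \<le> ((1 - \<tau>) * (g q - 1 - ln (R - norm q)) - C) / \<tau>"
      using filterlim_ln_norm_at_bot[of q] unfolding filterlim_at_bot by blast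
    moreover have "\<forall>\<^sub>F x in at q. x \<noteq> q" by (simp add: eventually_at_filter)
    ultimately show ?thesis using C
    proof eventually_elim
      case (elim x)
      have "h x = ln (norm (x - q) / (R - norm q)) + g x"
        unfolding h_def g_def using q Q(1) by (subst sum.remove[of _ q]) auto
      also have "ln (norm (x - q) / (R - norm q)) = ln (norm (x - q)) - ln (R - norm q)"
        using elim(3) R[OF q] by (simp add: ln_div)
      finally have "ln (norm (x - q)) + (g q - 1 - ln (R - norm q)) \<le> h x" using elim(1) by simp
      then have "(1 - \<tau>) * (ln (norm (x - q)) + (g q - 1 - ln (R - norm q))) \<le> (1 - \<tau>) * h x"
        using \<tau> by (intro mult_left_mono) auto
      moreover have "\<tau> * ln (norm (x - q)) \<le> (1 - \<tau>) * (g q - 1 - ln (R - norm q)) - C"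
        using elim(2) \<tau> by (simp add: field_simps)
      ultimately have "ln (norm (x - q)) + C \<le> (1 - \<tau>) * h x"
        by (simp add: algebra_simps)
      then show ?case using elim(4) by (meson ereal_less_eq(3) order_trans)
    qed
  qed
  have main: "u (\<phi> x0) \<le> ereal ((1 - \<tau>) * h x0)" if \<tau>: "0 < \<tau>" "\<tau> < 1" for \<tau>
  proof -
    let ?near = "\<lambda>q s. \<forall>x. x \<noteq> q \<and> dist x q \<le> s \<longrightarrow> u (\<phi> x) \<le> ereal ((1 - \<tau>) * h x)"
    have "\<forall>\<^sub>F s in at_right 0. \<forall>q\<in>Q. ?near q s \<and> s < dist x0 q"
    proof (intro eventually_ball_finite[OF Q(1)] ballI)
      fix q assume q: "q \<in> Q"
      obtain d where d: "d > 0" "\<And>x. x \<noteq> q \<Longrightarrow> dist x q < d \<Longrightarrow> u (\<phi> x) \<le> ereal ((1 - \<tau>) * h x)"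
        using pole[OF q \<tau>] unfolding eventually_at by auto
      have "0 < min d (dist x0 q)" using d(1) x0(2) q by auto
      then have "\<forall>\<^sub>F s in at_right 0. s < min d (dist x0 q)"
        by (rule order_tendstoD(2)[OF tendsto_ident_at])
      then show "\<forall>\<^sub>F s in at_right 0. ?near q s \<and> s < dist x0 q"
        by eventually_elim (use d(2) in auto)
    qed
    moreover have "\<forall>\<^sub>F s::real in at_right 0. 0 < s" by (simp add: eventually_at_right_less)
    ultimately have "\<forall>\<^sub>F s in at_right 0. 0 < s \<and> (\<forall>q\<in>Q. ?near q s \<and> s < dist x0 q)"
      by eventually_elim auto
    then have "\<exists>s. 0 < s \<and> (\<forall>q\<in>Q. ?near q s \<and> s < dist x0 q)"
      by (rule eventually_happens'[rotated]) simp
    then obtain s where s: "s > 0"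
      and near: "\<And>q x. q \<in> Q \<Longrightarrow> x \<noteq> q \<Longrightarrow> dist x q \<le> s \<Longrightarrow> u (\<phi> x) \<le> ereal ((1 - \<tau>) * h x)"
      and far: "\<And>q. q \<in> Q \<Longrightarrow> s < dist x0 q"
      by blast
    define Z where "Z = cball 0 R - (\<Union>q\<in>Q. ball q s)"
    define U where "U = ball 0 R - (\<Union>q\<in>Q. cball q s)"
    have QZ: "q \<notin> Z" if "q \<in> Q" for q
      using that s unfolding Z_def by (auto intro!: bexI[of _ q])
    have UZ: "U \<subseteq> Z"
    proof
      fix x assume "x \<in> U"
      then show "x \<in> Z" unfolding U_def Z_def by (auto simp: not_less dest: less_imp_le)
    qed
    have "v (x0, p x0) \<le> ereal ((1 - \<tau>) * h x0)"
    proof (rule psh_graph_maximum_principle[OF psh openL, where Z = Z and U = U])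
      show "compact Z" unfolding Z_def by (intro compact_diff) auto
      show "open U" unfolding U_def using Q(1) by (intro open_Diff closed_UN) auto
      show "U \<subseteq> Z" by (rule UZ)
      show "continuous_on Z p" by (rule continuous_on_subset[OF p(1)]) (auto simp: Z_def)
      show "p holomorphic_on U" by (rule holomorphic_on_subset[OF p(2)]) (auto simp: U_def)
      show "(x, p x) \<in> L -` \<Omega>" if "x \<in> Z" for x using graph[of x] that by (simp add: L_def Z_def)
      show "continuous_on Z (\<lambda>x. (1 - \<tau>) * h x)"
        unfolding h_def using R QZ by (intro continuous_intros) (auto simp: less_le)
      show "x0 \<in> U" using x0 far by (force simp: U_def dist_commute)
      show "v (x, p x) \<le> ereal ((1 - \<tau>) * h x)" if x: "x \<in> Z - U" for x
      proof (cases "norm x = R")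
        case True
        have "u (\<phi> x) \<le> 0" using u graph[of x] True unfolding psh_nonpos_def \<phi>_def by auto
        moreover have "0 \<le> (1 - \<tau>) * h x"
          unfolding h_def
        proof (intro mult_nonneg_nonneg sum_nonneg)
          fix q assume q: "q \<in> Q"
          have "R - norm q \<le> norm (x - q)" using True norm_triangle_ineq2[of x q] by simp
          then show "0 \<le> ln (norm (x - q) / (R - norm q))" using R[OF q] by simp
        qed (use \<tau> in auto)
        ultimately show ?thesis unfolding v by (meson ereal_less_eq(5) order_trans)
      next
        case False
        with x obtain q where q: "q \<in> Q" "dist q x \<le> s" by (auto simp: Z_def U_def)
        then show ?thesis using near[of q x] QZ[of q] x unfolding v by (auto simp: dist_commute)
      qed
      show "\<exists>r>0. \<exists>H. H holomorphic_on ball x r \<and> (\<forall>y\<in>ball x r. (1 - \<tau>) * h y = Re (H y))" if x: "x \<in> U" for x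
      proof -
        obtain r where r: "r > 0" "ball x r \<subseteq> U"
          using openE[OF \<open>open U\<close> x] by blast
        then have "Q \<inter> ball x r = {}" using QZ UZ by blast
        from sum_ln_norm_eq_Re_holomorphic[OF Q(1) this r(1), of "\<lambda>q. R - norm q"] R
        obtain H where H: "H holomorphic_on ball x r" "\<And>y. y \<in> ball x r \<Longrightarrow> h y = Re (H y)"
          unfolding h_def by auto
        have "(\<lambda>y. of_real (1 - \<tau>) * H y) holomorphic_on ball x r" by (intro holomorphic_intros H(1))
        moreover have "(1 - \<tau>) * h y = Re (of_real (1 - \<tau>) * H y)" if "y \<in> ball x r" for y
          using H(2)[OF that] by simp
        ultimately show ?thesis using r(1) by blast
      qed
    qed
    then show ?thesis unfolding v .
  qed
  have "((\<lambda>\<tau>. ereal ((1 - \<tau>) * h x0)) \<longlongrightarrow> ereal ((1 - 0) * h x0)) (at_right 0)"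
    by (intro tendsto_intros)
  moreover have "\<forall>\<^sub>F \<tau>::real in at_right 0. 0 < \<tau> \<and> \<tau> < 1"
    using eventually_at_right_real[OF zero_less_one] by eventually_elim auto
  then have "\<forall>\<^sub>F \<tau> in at_right 0. u (\<phi> x0) \<le> ereal ((1 - \<tau>) * h x0)"
    by eventually_elim (use main in auto)
  ultimately have "u (\<phi> x0) \<le> ereal ((1 - 0) * h x0)"
    by (rule tendsto_lowerbound) simp
  then show ?thesis by (simp add: \<phi>_def h_def)
qed

section \<open>Competitors made of affine forms\<close>

text \<open>The function \<open>- log |w|\<close> with its value \<open>\<infinity>\<close> at \<open>0\<close>, truncated to \<open>0\<close> where \<open>|w| > 1\<close>.
  For a nonpositive function only the negative part enters the circle mean, so working with the negative in \<^typ>\<open>ennreal\<close> avoids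
  all differences of infinities.\<close>

definition neglog :: "complex \<Rightarrow> ennreal" where
  "neglog w = (if w = 0 then \<infinity> else ennreal (- ln (norm w)))"

lemma neglog_antimono: "norm w \<le> norm w' \<Longrightarrow> neglog w' \<le> neglog w"
  by (auto simp: neglog_def intro!: ennreal_leI)

lemma continuous_on_neglog: "continuous_on UNIV neglog"
  unfolding continuous_on_def
proof
  fix w :: complex
  have ev: "\<forall>\<^sub>F x in at w. ennreal (- ln (norm x)) = neglog x"
    using eventually_neq_at_within[of 0 w UNIV] by eventually_elim (simp add: neglog_def)
  have "((\<lambda>x. ennreal (- ln (norm x))) \<longlongrightarrow> neglog w) (at w)"
  proof (cases "w = 0")
    case False
    have "((\<lambda>x. ennreal (- ln (norm x))) \<longlongrightarrow> ennreal (- ln (norm w))) (at w)"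
      using False by (intro tendsto_intros) auto
    then show ?thesis using False by (simp add: neglog_def)
  next
    case True
    have "filterlim (\<lambda>x::complex. norm x) (at_right 0) (at 0)"
      unfolding filterlim_at by (auto simp: eventually_at_filter intro!: tendsto_eq_intros)
    then have "filterlim (\<lambda>x::complex. ln (norm x)) at_bot (at 0)"
      by (rule filterlim_compose[OF ln_at_0])
    then have "filterlim (\<lambda>x::complex. - ln (norm x)) at_top (at 0)"
      by (simp add: filterlim_uminus_at_bot)
    then show ?thesis using True by (simp add: neglog_def ennreal_tendsto_top_eq_at_top)
  qed
  then show "(neglog \<longlongrightarrow> neglog w) (at w within UNIV)"
    by (rule Lim_transform_eventually[OF _ ev])
qed

lemma borel_measurable_neglog [measurable]: "neglog \<in> borel_measurable borel"
  using continuous_on_neglog by (rule borel_measurable_continuous_onI)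

text \<open>Here \<open>\<alpha> + \<beta> x\<close> has no zero in the closed unit disk, so \<open>log |\<alpha> + \<beta> x|\<close> is harmonic and its mean
  over the unit circle is the value at \<open>0\<close>.\<close>

lemma nn_integral_neglog_circle_nonzero:
  assumes ab: "norm \<beta> < norm \<alpha>" and le: "\<And>t. norm (\<alpha> + \<beta> * cis t) \<le> 1"
  shows "(\<integral>\<^sup>+t\<in>{0..2*pi}. neglog (\<alpha> + \<beta> * cis t) \<partial>lborel) \<le> ennreal (2 * pi) * neglog \<alpha>"
proof -
  have \<alpha>: "\<alpha> \<noteq> 0" using ab by auto
  define f where "f x = Ln (1 + \<beta> / \<alpha> * x)" for x
  have pos: "0 < Re (1 + \<beta> / \<alpha> * x)" if "norm x \<le> 1" for x
  proof -
    have "norm (\<beta> / \<alpha> * x) \<le> norm (\<beta> / \<alpha>) * 1"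
      unfolding norm_mult using that by (intro mult_left_mono) auto
    also have "\<dots> < 1" using ab \<alpha> by (simp add: norm_divide)
    finally show ?thesis using abs_Re_le_cmod[of "\<beta> / \<alpha> * x"] by simp
  qed
  have "((\<lambda>t. f (0 + rcis 1 t)) has_integral 2 * pi * f 0) {0..2*pi}"
  proof (rule integral_circle_holomorphic)
    have nonpos: "1 + \<beta> / \<alpha> * x \<notin> \<real>\<^sub>\<le>\<^sub>0" if "norm x \<le> 1" for x
      using pos[OF that] by (auto simp: complex_nonpos_Reals_iff)
    then show "continuous_on (cball 0 1) f"
      unfolding f_def by (intro continuous_intros) auto
    show "f holomorphic_on ball 0 1"
      unfolding f_def using nonpos by (intro holomorphic_intros) auto
  qed simp
  from has_integral_Re[OF this] have "((\<lambda>t. Re (f (cis t))) has_integral 0) {0..2*pi}"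
    by (simp add: f_def rcis_def)
  then have "((\<lambda>t. - Re (f (cis t)) + - ln (norm \<alpha>)) has_integral - 0 + (2 * pi - 0) *\<^sub>R - ln (norm \<alpha>)) {0..2*pi}"
    by (intro has_integral_add has_integral_neg) (use has_integral_const_real[of "- ln (norm \<alpha>)" 0 "2*pi"] in simp_all)
  moreover have nz: "\<alpha> + \<beta> * cis t \<noteq> 0" and eq: "- Re (f (cis t)) + - ln (norm \<alpha>) = - ln (norm (\<alpha> + \<beta> * cis t))" for t
  proof -
    have 1: "\<alpha> * (1 + \<beta> / \<alpha> * cis t) = \<alpha> + \<beta> * cis t" using \<alpha> by (simp add: field_simps)
    have "0 < Re (1 + \<beta> / \<alpha> * cis t)" by (rule pos) simp
    then have 2: "1 + \<beta> / \<alpha> * cis t \<noteq> 0" by (metis less_irrefl zero_complex.sel(1))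
    show "\<alpha> + \<beta> * cis t \<noteq> 0" using 1 2 \<alpha> by (metis mult_eq_0_iff)
    show "- Re (f (cis t)) + - ln (norm \<alpha>) = - ln (norm (\<alpha> + \<beta> * cis t))"
      unfolding f_def 1[symmetric] norm_mult using 2 \<alpha> by (simp add: ln_mult)
  qed
  ultimately have I: "((\<lambda>t. - ln (norm (\<alpha> + \<beta> * cis t))) has_integral 2 * pi * - ln (norm \<alpha>)) {0..2*pi}"
    by simp
  have ge: "0 \<le> - ln (norm (\<alpha> + \<beta> * cis t))" for t using le[of t] nz[of t] by simp
  have "(\<integral>\<^sup>+t\<in>{0..2*pi}. neglog (\<alpha> + \<beta> * cis t) \<partial>lborel)
      = (\<integral>\<^sup>+t. ennreal (indicator {0..2*pi} t * - ln (norm (\<alpha> + \<beta> * cis t))) \<partial>lborel)"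
    by (intro nn_integral_cong) (auto simp: neglog_def nz indicator_def)
  also have "\<dots> = ennreal (2 * pi * - ln (norm \<alpha>))"
  proof (rule nn_integral_has_integral_lborel)
    show "(\<lambda>t. indicator {0..2*pi} t * - ln (norm (\<alpha> + \<beta> * cis t))) \<in> borel_measurable borel"
      unfolding cis_conv_exp by measurable
    show "((\<lambda>t. indicator {0..2*pi} t * - ln (norm (\<alpha> + \<beta> * cis t))) has_integral 2 * pi * - ln (norm \<alpha>)) UNIV"
      using has_integral_restrict_UNIV[THEN iffD2, OF I]
      by (rule has_integral_eq[rotated]) (auto simp: indicator_def)
  qed (use ge in \<open>auto simp: indicator_def\<close>)
  also have "\<dots> = ennreal (2 * pi) * neglog \<alpha>"
    using \<alpha> by (simp add: neglog_def ennreal_mult' flip: ennreal_mult')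
  finally show ?thesis by simp
qed

text \<open>If \<open>|\<alpha>| < |\<beta>|\<close> one exchanges the roles of the coefficients, because
  \<open>|\<alpha> + \<beta> x| = |cnj \<beta> + cnj \<alpha> x|\<close> for \<open>|x| = 1\<close>, and the mean of \<open>log |\<alpha> + \<beta> x|\<close> is
  \<open>log |\<beta>| > log |\<alpha>|\<close>. If \<open>|\<alpha>| = |\<beta>| \<noteq> 0\<close> there is a zero on
  the circle itself, and Fatou's lemma along \<open>c \<beta>\<close> with \<open>c \<longlonglongrightarrow> 1\<close> gives the inequality.\<close>

lemma nn_integral_neglog_circle:
  assumes le: "\<And>t. norm (\<alpha> + \<beta> * cis t) \<le> 1"
  shows "(\<integral>\<^sup>+t\<in>{0..2*pi}. neglog (\<alpha> + \<beta> * cis t) \<partial>lborel) \<le> ennreal (2 * pi) * neglog \<alpha>"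
proof (cases "norm \<alpha>" "norm \<beta>" rule: linorder_cases)
  case greater
  then show ?thesis using le by (intro nn_integral_neglog_circle_nonzero) auto
next
  case less
  have flip: "norm (\<alpha> + \<beta> * cis t) = norm (cnj \<beta> + cnj \<alpha> * cis t)" for t
  proof -
    have eq: "\<alpha> + \<beta> * cis t = cis t * cnj (cnj \<beta> + cnj \<alpha> * cis t)"
      by (simp add: distrib_left cis_cnj) (simp add: cis_mult mult.left_commute)
    show ?thesis by (subst eq) (simp only: norm_mult complex_mod_cnj norm_cis mult_1)
  qed
  have "neglog (\<alpha> + \<beta> * cis t) = neglog (cnj \<beta> + cnj \<alpha> * cis t)" for t
    using flip[of t] by (intro antisym neglog_antimono) auto
  then have "(\<integral>\<^sup>+t\<in>{0..2*pi}. neglog (\<alpha> + \<beta> * cis t) \<partial>lborel) \<le> ennreal (2 * pi) * neglog (cnj \<beta>)"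
    using less le flip by (auto intro!: nn_integral_neglog_circle_nonzero)
  also have "\<dots> \<le> ennreal (2 * pi) * neglog \<alpha>"
    using less by (intro mult_left_mono neglog_antimono) auto
  finally show ?thesis .
next
  case equal
  show ?thesis
  proof (cases "\<alpha> = 0")
    case True
    then show ?thesis by (simp add: neglog_def ennreal_mult_top)
  next
    case False
    define c where "c n = 1 - inverse (real (Suc n))" for n
    have c: "0 \<le> c n" "c n < 1" for n by (auto simp: c_def field_simps)
    have clim: "c \<longlonglongrightarrow> 1 - 0" unfolding c_def by (intro tendsto_intros LIMSEQ_inverse_real_of_nat)
    have \<alpha>1: "norm \<alpha> \<le> 1"
    proof -
      have "2 * norm \<alpha> = norm ((\<alpha> + \<beta> * cis 0) + (\<alpha> + \<beta> * cis pi))" by simp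
      also have "\<dots> \<le> norm (\<alpha> + \<beta> * cis 0) + norm (\<alpha> + \<beta> * cis pi)" by (rule norm_triangle_ineq)
      finally show ?thesis using le[of 0] le[of pi] by linarith
    qed
    have le': "norm (\<alpha> + of_real (c n) * \<beta> * cis t) \<le> 1" for n t
    proof -
      have "\<alpha> + of_real (c n) * \<beta> * cis t = of_real (1 - c n) * \<alpha> + of_real (c n) * (\<alpha> + \<beta> * cis t)"
        by (simp add: algebra_simps)
      also have "norm \<dots> \<le> (1 - c n) * norm \<alpha> + c n * norm (\<alpha> + \<beta> * cis t)"
        using c[of n] by (intro order_trans[OF norm_triangle_ineq]) (simp add: norm_mult del: of_real_diff)
      also have "\<dots> \<le> (1 - c n) * 1 + c n * 1"
        using c[of n] \<alpha>1 le by (intro add_mono mult_left_mono) auto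
      finally show ?thesis by simp
    qed
    have lim: "(\<lambda>n. neglog (\<alpha> + of_real (c n) * \<beta> * cis t) * indicator {0..2*pi} t)
        \<longlonglongrightarrow> neglog (\<alpha> + \<beta> * cis t) * indicator {0..2*pi} t" for t
    proof -
      have "(\<lambda>n. \<alpha> + of_real (c n) * \<beta> * cis t) \<longlonglongrightarrow> \<alpha> + of_real (1 - 0) * \<beta> * cis t"
        by (intro tendsto_intros clim)
      then have "(\<lambda>n. neglog (\<alpha> + of_real (c n) * \<beta> * cis t)) \<longlonglongrightarrow> neglog (\<alpha> + \<beta> * cis t)"
        using continuous_on_tendsto_compose[OF continuous_on_neglog] by simp
      then show ?thesis by (cases "t \<in> {0..2*pi}") auto
    qed
    have "(\<integral>\<^sup>+t\<in>{0..2*pi}. neglog (\<alpha> + \<beta> * cis t) \<partial>lborel)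
        = (\<integral>\<^sup>+t. liminf (\<lambda>n. neglog (\<alpha> + of_real (c n) * \<beta> * cis t) * indicator {0..2*pi} t) \<partial>lborel)"
      using lim_imp_Liminf[OF sequentially_bot lim] by simp
    also have "\<dots> \<le> liminf (\<lambda>n. \<integral>\<^sup>+t\<in>{0..2*pi}. neglog (\<alpha> + of_real (c n) * \<beta> * cis t) \<partial>lborel)"
      unfolding cis_conv_exp by (rule nn_integral_liminf) measurable
    also have "\<dots> \<le> liminf (\<lambda>n::nat. ennreal (2 * pi) * neglog \<alpha>)"
    proof (intro Liminf_mono always_eventually allI)
      fix n
      have "\<beta> \<noteq> 0" using equal False by (metis norm_eq_zero)
      then have "norm (of_real (c n) * \<beta>) < norm \<alpha>"
        using c[of n] equal \<open>\<beta> \<noteq> 0\<close> by (simp add: norm_mult)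
      then show "(\<integral>\<^sup>+t\<in>{0..2*pi}. neglog (\<alpha> + of_real (c n) * \<beta> * cis t) \<partial>lborel) \<le> ennreal (2 * pi) * neglog \<alpha>"
        using le' by (rule nn_integral_neglog_circle_nonzero)
    qed
    also have "\<dots> = ennreal (2 * pi) * neglog \<alpha>" by (simp add: Liminf_const)
    finally show ?thesis .
  qed
qed

text \<open>For a nonpositive function the mean value inequality is an upper bound for the integral of its
  negative. Since \<open>a1, a2, b1, b2\<close> are arbitrary, the unit circle stands for all circles in all lines.\<close>

lemma psh_nonpos_uminus_enn2ereal:
  fixes N :: "complex \<times> complex \<Rightarrow> ennreal"
  assumes cont: "continuous_on \<Omega> N"
    and mean: "\<And>a1 a2 b1 b2. (\<And>t. t \<in> cball 0 1 \<Longrightarrow> (a1 + t * b1, a2 + t * b2) \<in> \<Omega>) \<Longrightarrow>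
      (\<integral>\<^sup>+t\<in>{0..2*pi}. N (a1 + cis t * b1, a2 + cis t * b2) \<partial>lborel) \<le> ennreal (2 * pi) * N (a1, a2)"
  shows "(\<lambda>z. - enn2ereal (N z)) \<in> psh_nonpos \<Omega>"
proof -
  have fin: "- enn2ereal n < \<infinity>" for n
    by (rule le_less_trans[of _ 0]) auto
  have usc: "usc_on \<Omega> (\<lambda>z. - enn2ereal (N z))"
    unfolding usc_on_def
  proof (intro ballI allI impI)
    fix x c assume x: "x \<in> \<Omega>" and c: "- enn2ereal (N x) < c"
    have "((\<lambda>z. - enn2ereal (N z)) \<longlongrightarrow> - enn2ereal (N x)) (at x within \<Omega>)"
      using cont x unfolding continuous_on_def by (intro tendsto_intros) auto
    then show "\<forall>\<^sub>F y in at x within \<Omega>. - enn2ereal (N y) < c"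
      using c by (rule order_tendstoD)
  qed
  have sub: "subharmonic_on {t. (a1 + t * b1, a2 + t * b2) \<in> \<Omega>} (\<lambda>t. - enn2ereal (N (a1 + t * b1, a2 + t * b2)))"
    for a1 a2 b1 b2
    unfolding subharmonic_on_def
  proof (intro conjI ballI allI impI)
    let ?A = "{t. (a1 + t * b1, a2 + t * b2) \<in> \<Omega>}" and ?u = "\<lambda>t. - enn2ereal (N (a1 + t * b1, a2 + t * b2))"
    show "usc_on ?A ?u"
      by (rule usc_on_compose[OF usc]) (auto intro!: continuous_intros)
    fix a :: complex and r :: real assume r: "0 < r \<and> cball a r \<subseteq> ?A"
    define I where "I = (\<integral>\<^sup>+t\<in>{0..2*pi}. N (a1 + (a + rcis r t) * b1, a2 + (a + rcis r t) * b2) \<partial>lborel)"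
    have "(\<integral>\<^sup>+t\<in>{0..2*pi}. N ((a1 + a * b1) + cis t * (r * b1), (a2 + a * b2) + cis t * (r * b2)) \<partial>lborel)
        \<le> ennreal (2 * pi) * N (a1 + a * b1, a2 + a * b2)"
    proof (rule mean)
      fix t :: complex assume "t \<in> cball 0 1"
      then have "a + r * t \<in> cball a r" using r by (simp add: dist_norm norm_mult mult_left_le)
      then have "a + r * t \<in> ?A" using r by blast
      then show "(a1 + a * b1 + t * (r * b1), a2 + a * b2 + t * (r * b2)) \<in> \<Omega>"
        by (simp add: algebra_simps)
    qed
    then have I: "I \<le> ennreal (2 * pi) * N (a1 + a * b1, a2 + a * b2)"
      by (simp add: I_def rcis_def algebra_simps)
    have "circle_mean ?u a r = (0 - enn2ereal I) / ereal (2 * pi)"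
      unfolding circle_mean_def I_def by (simp add: e2ennreal_neg zero_ennreal.rep_eq)
    moreover have "- enn2ereal n \<le> (0 - enn2ereal I) / ereal (2 * pi)" if "I \<le> ennreal (2 * pi) * n" for n
    proof (cases n)
      case (real n')
      then have "I \<le> ennreal (2 * pi * n')" using that by (simp add: ennreal_mult')
      then obtain i where "I = ennreal i" "0 \<le> i" "i \<le> 2 * pi * n'"
        using real by (cases I) (auto simp: top_unique)
      then show ?thesis using real by (simp add: enn2ereal_ennreal field_simps)
    qed simp
    ultimately show "?u a \<le> circle_mean ?u a r" using I by simp
  qed (rule fin)
  show ?thesis
    unfolding psh_nonpos_def psh_on_def using usc sub fin by auto
qed

text \<open>Each of the at least \<open>m\<close> forms that vanish at \<open>a\<close> contributes at most \<open>log |w - a| + O(1)\<close>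
  to the sum before it is divided by \<open>m\<close>, and the other terms are bounded above by \<open>0\<close>.\<close>

lemma log_pole_at_sum_neglog:
  fixes c \<alpha> \<beta> :: "'j \<Rightarrow> complex"
  defines "l \<equiv> \<lambda>j z. c j + \<alpha> j * fst z + \<beta> j * snd z"
  assumes J: "finite J" and m: "m > 0" "m \<le> card {j\<in>J. l j a = 0}"
  shows "log_pole_at a (\<lambda>z. - enn2ereal (ennreal (1 / real m) * (\<Sum>j\<in>J. neglog (l j z))))"
proof -
  define K where "K = 1 + (\<Sum>j\<in>J. norm (\<alpha> j) + norm (\<beta> j))"
  have K: "K > 0" unfolding K_def by (intro add_pos_nonneg sum_nonneg) auto
  have lip: "norm (l j w) \<le> K * norm (w - a)" if j: "j \<in> J" "l j a = 0" for j w
  proof -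
    have "l j w = \<alpha> j * fst (w - a) + \<beta> j * snd (w - a)"
      using j(2) by (simp add: l_def algebra_simps eq_diff_eq)
    also have "norm \<dots> \<le> norm (\<alpha> j) * norm (fst (w - a)) + norm (\<beta> j) * norm (snd (w - a))"
      by (rule order_trans[OF norm_triangle_ineq]) (simp only: norm_mult order_refl)
    also have "\<dots> \<le> norm (\<alpha> j) * norm (w - a) + norm (\<beta> j) * norm (w - a)"
      using norm_fst_le[of "fst (w - a)" "snd (w - a)"] norm_snd_le[of "snd (w - a)" "fst (w - a)"]
      by (intro add_mono mult_left_mono) (simp_all only: prod.collapse norm_ge_zero)
    also have "\<dots> = (norm (\<alpha> j) + norm (\<beta> j)) * norm (w - a)" by (simp add: algebra_simps)
    also have "\<dots> \<le> K * norm (w - a)"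
    proof (rule mult_right_mono)
      have "norm (\<alpha> j) + norm (\<beta> j) \<le> (\<Sum>j\<in>J. norm (\<alpha> j) + norm (\<beta> j))"
        using J j(1) by (intro member_le_sum) auto
      then show "norm (\<alpha> j) + norm (\<beta> j) \<le> K" by (simp add: K_def)
    qed simp
    finally show ?thesis .
  qed
  have "\<forall>\<^sub>F w in at a. K * norm (w - a) < 1"
  proof (rule order_tendstoD)
    show "((\<lambda>w. K * norm (w - a)) \<longlongrightarrow> K * norm (a - a)) (at a)" by (intro tendsto_intros)
  qed simp
  moreover have "\<forall>\<^sub>F w in at a. w \<noteq> a" by (simp add: eventually_at_filter)
  ultimately have "\<forall>\<^sub>F w in at a. - enn2ereal (ennreal (1 / real m) * (\<Sum>j\<in>J. neglog (l j w)))
      \<le> ereal (ln (norm (w - a)) + ln K)"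
  proof eventually_elim
    case (elim w)
    define b where "b = - ln (K * norm (w - a))"
    have pos: "0 < K * norm (w - a)" using K elim by simp
    then have b: "b > 0" using elim by (simp add: b_def)
    have nb: "ennreal b \<le> neglog (l j w)" if "j \<in> {j\<in>J. l j a = 0}" for j
    proof (cases "l j w = 0")
      case False
      have "ln (norm (l j w)) \<le> ln (K * norm (w - a))"
        using False lip[of j w] that by (intro ln_mono) auto
      then show ?thesis using False by (auto simp: neglog_def b_def intro!: ennreal_leI)
    qed (simp add: neglog_def)
    have "ennreal (real m * b) = of_nat m * ennreal b"
      using b by (simp add: ennreal_mult' flip: ennreal_of_nat_eq_real_of_nat)
    also have "\<dots> \<le> of_nat (card {j\<in>J. l j a = 0}) * ennreal b"
      using m(2) by (intro mult_right_mono) auto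
    also have "\<dots> = (\<Sum>j\<in>{j\<in>J. l j a = 0}. ennreal b)" by simp
    also have "\<dots> \<le> (\<Sum>j\<in>{j\<in>J. l j a = 0}. neglog (l j w))"
      using nb by (rule sum_mono)
    also have "\<dots> \<le> (\<Sum>j\<in>J. neglog (l j w))"
      using J by (intro sum_mono2) auto
    finally have "ennreal (1 / real m) * ennreal (real m * b) \<le> ennreal (1 / real m) * (\<Sum>j\<in>J. neglog (l j w))"
      by (rule mult_left_mono) simp
    moreover have "ennreal (1 / real m) * ennreal (real m * b) = ennreal b"
      using m(1) b by (simp flip: ennreal_mult)
    ultimately have "ennreal b \<le> ennreal (1 / real m) * (\<Sum>j\<in>J. neglog (l j w))" by simp
    then have "ereal b \<le> enn2ereal (ennreal (1 / real m) * (\<Sum>j\<in>J. neglog (l j w)))"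
      using b by (simp add: less_eq_ennreal.rep_eq enn2ereal_ennreal)
    then have "- enn2ereal (ennreal (1 / real m) * (\<Sum>j\<in>J. neglog (l j w))) \<le> - ereal b"
      by (simp only: ereal_minus_le_minus)
    also have "- ereal b = ereal (ln (norm (w - a)) + ln K)"
      using K elim(2) by (simp add: b_def ln_mult)
    finally show ?case .
  qed
  then show ?thesis unfolding log_pole_at_def by blast
qed

lemma psh_nonpos_sum_neglog:
  fixes c \<alpha> \<beta> :: "'j \<Rightarrow> complex"
  defines "l \<equiv> \<lambda>j z. c j + \<alpha> j * fst z + \<beta> j * snd z"
  assumes bound: "\<And>j z. j \<in> J \<Longrightarrow> z \<in> \<Omega> \<Longrightarrow> norm (l j z) \<le> 1"
  shows "(\<lambda>z. - enn2ereal (ennreal (1 / real m) * (\<Sum>j\<in>J. neglog (l j z)))) \<in> psh_nonpos \<Omega>"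
proof (rule psh_nonpos_uminus_enn2ereal)
  have "continuous_on \<Omega> (\<lambda>z. neglog (l j z))" for j
    by (rule continuous_on_compose2[OF continuous_on_neglog]) (auto simp: l_def intro!: continuous_intros)
  then have "continuous_on \<Omega> (\<lambda>z. \<Sum>j\<in>J. neglog (l j z))"
    by (intro continuous_on_sum)
  then show "continuous_on \<Omega> (\<lambda>z. ennreal (1 / real m) * (\<Sum>j\<in>J. neglog (l j z)))"
    by (rule ennreal_continuous_on_cmult[rotated]) simp
  fix a1 a2 b1 b2
  assume line: "\<And>t. t \<in> cball 0 1 \<Longrightarrow> (a1 + t * b1, a2 + t * b2) \<in> \<Omega>"
  define \<gamma> where "\<gamma> j = \<alpha> j * b1 + \<beta> j * b2" for j
  have l: "l j (a1 + t * b1, a2 + t * b2) = l j (a1, a2) + \<gamma> j * t" for j t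
    by (simp add: l_def \<gamma>_def algebra_simps)
  have [measurable]: "(\<lambda>t. neglog (l j (a1, a2) + \<gamma> j * cis t)) \<in> borel_measurable borel" for j
    unfolding cis_conv_exp by measurable
  have "(\<integral>\<^sup>+t\<in>{0..2*pi}. ennreal (1 / real m) * (\<Sum>j\<in>J. neglog (l j (a1 + cis t * b1, a2 + cis t * b2))) \<partial>lborel)
      = (\<integral>\<^sup>+t. ennreal (1 / real m) * (\<Sum>j\<in>J. neglog (l j (a1, a2) + \<gamma> j * cis t) * indicator {0..2*pi} t) \<partial>lborel)"
    unfolding l by (simp add: sum_distrib_right mult.assoc)
  also have "\<dots> = ennreal (1 / real m) * (\<Sum>j\<in>J. \<integral>\<^sup>+t\<in>{0..2*pi}. neglog (l j (a1, a2) + \<gamma> j * cis t) \<partial>lborel)"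
    by (simp add: nn_integral_cmult nn_integral_sum)
  also have "\<dots> \<le> ennreal (1 / real m) * (\<Sum>j\<in>J. ennreal (2 * pi) * neglog (l j (a1, a2)))"
  proof (intro mult_left_mono sum_mono nn_integral_neglog_circle)
    fix j t assume "j \<in> J"
    then show "norm (l j (a1, a2) + \<gamma> j * cis t) \<le> 1"
      using bound[OF _ line[of "cis t"]] unfolding l by simp
  qed simp
  also have "\<dots> = ennreal (2 * pi) * (ennreal (1 / real m) * (\<Sum>j\<in>J. neglog (l j (a1, a2))))"
    by (simp add: sum_distrib_left mult_ac)
  finally show "(\<integral>\<^sup>+t\<in>{0..2*pi}. ennreal (1 / real m) * (\<Sum>j\<in>J. neglog (l j (a1 + cis t * b1, a2 + cis t * b2))) \<partial>lborel)
      \<le> ennreal (2 * pi) * (ennreal (1 / real m) * (\<Sum>j\<in>J. neglog (l j (a1, a2))))" .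
qed

text \<open>Dividing the sum of the logarithms by \<open>m\<close> leaves a logarithmic pole of weight at least one wherever
  at least \<open>m\<close> of the forms vanish, so the quotient is a competitor for the Green function.\<close>

lemma pluricomplex_green_ge_affine:
  fixes c \<alpha> \<beta> :: "'j \<Rightarrow> complex"
  defines "l \<equiv> \<lambda>j z. c j + \<alpha> j * fst z + \<beta> j * snd z"
  assumes J: "finite J" and m: "m > 0"
    and bound: "\<And>j z. j \<in> J \<Longrightarrow> z \<in> \<Omega> \<Longrightarrow> norm (l j z) \<le> 1"
    and poles: "\<And>a. a \<in> S \<Longrightarrow> m \<le> card {j\<in>J. l j a = 0}"
    and z: "z \<in> \<Omega>" "\<And>j. j \<in> J \<Longrightarrow> l j z \<noteq> 0"
  shows "ereal ((\<Sum>j\<in>J. ln (norm (l j z))) / real m) \<le> pluricomplex_green \<Omega> S z"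
proof -
  define u where "u z = - enn2ereal (ennreal (1 / real m) * (\<Sum>j\<in>J. neglog (l j z)))" for z
  have "u \<in> psh_nonpos \<Omega>"
    using psh_nonpos_sum_neglog[of J \<Omega> c \<alpha> \<beta> m] bound unfolding u_def l_def by blast
  moreover have "log_pole_at a u" if "a \<in> S" for a
    using log_pole_at_sum_neglog[OF J m, of c \<alpha> a \<beta>] poles[OF that] unfolding u_def l_def by blast
  ultimately have "u z \<le> pluricomplex_green \<Omega> S z"
    unfolding pluricomplex_green_def by (intro SUP_upper) auto
  moreover have "u z = ereal ((\<Sum>j\<in>J. ln (norm (l j z))) / real m)"
  proof -
    have nonneg: "0 \<le> - ln (norm (l j z))" if "j \<in> J" for j
      using bound[OF that z(1)] z(2)[OF that] by simp
    have "(\<Sum>j\<in>J. neglog (l j z)) = (\<Sum>j\<in>J. ennreal (- ln (norm (l j z))))"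
      using z(2) by (intro sum.cong) (auto simp: neglog_def)
    also have "\<dots> = ennreal (\<Sum>j\<in>J. - ln (norm (l j z)))"
      using nonneg by (rule sum_ennreal)
    finally have "u z = - enn2ereal (ennreal (1 / real m) * ennreal (\<Sum>j\<in>J. - ln (norm (l j z))))"
      by (simp only: u_def)
    moreover have "0 \<le> (\<Sum>j\<in>J. - ln (norm (l j z)))" using nonneg by (rule sum_nonneg)
    ultimately have "u z = - ereal (1 / real m * (\<Sum>j\<in>J. - ln (norm (l j z))))"
      by (simp add: enn2ereal_ennreal del: sum_negf flip: ennreal_mult)
    then show ?thesis by (simp add: sum_negf)
  qed
  ultimately show ?thesis by simp
qed

section \<open>Three poles in the bidisk\<close>

text \<open>The three lines through pairs of poles, each pole being on two of them. The denominators bound the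
  moduli of the forms on the bidisk.\<close>

lemma pluricomplex_green_three_poles_ge:
  assumes ne: "\<epsilon> \<noteq> \<rho>" "norm \<epsilon> < 1" and \<sigma>: "\<sigma> = \<delta> * \<rho> / (\<rho> - \<epsilon>)"
    and z: "(z1, z2) \<in> bidisk" "z2 \<noteq> 0" "z2 \<noteq> \<delta> * z1" "z2 \<noteq> \<sigma> * (z1 - \<epsilon>)"
  shows "ereal ((ln (norm z2) + ln (norm (z2 - \<delta> * z1) / (1 + norm \<delta>))
       + ln (norm (z2 - \<sigma> * (z1 - \<epsilon>)) / (1 + 2 * norm \<sigma>))) / 2)
     \<le> pluricomplex_green bidisk {(0, 0), (\<epsilon>, 0), (\<rho>, \<delta> * \<rho>)} (z1, z2)"
proof -
  define d s :: complex where "d = of_real (1 + norm \<delta>)" and "s = of_real (1 + 2 * norm \<sigma>)"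
  have ds: "norm d = 1 + norm \<delta>" "norm s = 1 + 2 * norm \<sigma>"
    unfolding d_def s_def norm_of_real by auto
  then have ds0: "d \<noteq> 0" "s \<noteq> 0"
    by (metis add_nonneg_eq_0_iff mult_nonneg_nonneg norm_ge_zero norm_zero zero_le_numeral zero_le_one zero_neq_one)+
  define c where "c = (\<lambda>_::nat. 0::complex)(2 := \<sigma> * \<epsilon> / s)"
  define \<alpha> where "\<alpha> = (\<lambda>_::nat. 0::complex)(1 := - \<delta> / d, 2 := - \<sigma> / s)"
  define \<beta> where "\<beta> = (\<lambda>_::nat. 1::complex)(1 := 1 / d, 2 := 1 / s)"
  define l where "l j z = c j + \<alpha> j * fst z + \<beta> j * snd z" for j z
  have l: "l 0 z = snd z" "l 1 z = (snd z - \<delta> * fst z) / d" "l 2 z = (snd z - \<sigma> * (fst z - \<epsilon>)) / s" for z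
    using ds0 by (auto simp: l_def c_def \<alpha>_def \<beta>_def field_simps)
  have J: "{..<3::nat} = {0, 1, 2}" by auto
  have "ereal ((\<Sum>j<3. ln (norm (l j (z1, z2)))) / real 2) \<le> pluricomplex_green bidisk {(0, 0), (\<epsilon>, 0), (\<rho>, \<delta> * \<rho>)} (z1, z2)"
    unfolding l_def
  proof (rule pluricomplex_green_ge_affine; (fold l_def)?)
    fix j z assume "j \<in> {..<3::nat}" and "z \<in> bidisk"
    then have j: "j = 0 \<or> j = 1 \<or> j = 2" and b: "norm (fst z) \<le> 1" "norm (snd z) \<le> 1"
      by (auto simp: bidisk_def)
    have "norm (snd z - \<delta> * fst z) \<le> norm (snd z) + norm \<delta> * norm (fst z)"
      by (metis norm_mult norm_triangle_ineq4)
    then have 1: "norm (snd z - \<delta> * fst z) \<le> 1 + norm \<delta>"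
      using b mult_left_mono[OF b(1) norm_ge_zero[of \<delta>]] by simp
    have "norm (snd z - \<sigma> * (fst z - \<epsilon>)) \<le> norm (snd z) + norm \<sigma> * norm (fst z - \<epsilon>)"
      by (metis norm_mult norm_triangle_ineq4)
    moreover have "norm (fst z - \<epsilon>) \<le> 2" using b ne(2) norm_triangle_ineq4[of "fst z" \<epsilon>] by simp
    ultimately have 2: "norm (snd z - \<sigma> * (fst z - \<epsilon>)) \<le> 1 + 2 * norm \<sigma>"
      using b mult_left_mono[OF _ norm_ge_zero[of \<sigma>], of "norm (fst z - \<epsilon>)" 2] by simp
    show "norm (l j z) \<le> 1"
      using j
    proof (elim disjE)
      assume "j = 1"
      then show ?thesis using 1 by (simp only: l norm_divide ds) (simp add: divide_le_eq_1 add_pos_nonneg)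
    next
      assume "j = 2"
      then show ?thesis using 2 by (simp only: l norm_divide ds) (simp add: divide_le_eq_1 add_pos_nonneg)
    qed (use b l in simp)
  next
    fix a assume "a \<in> {(0, 0), (\<epsilon>, 0), (\<rho>, \<delta> * \<rho>)}"
    then consider "a = (0, 0)" | "a = (\<epsilon>, 0)" | "a = (\<rho>, \<delta> * \<rho>)" by auto
    then have "\<exists>i k. i \<noteq> k \<and> {i, k} \<subseteq> {j\<in>{..<3::nat}. l j a = 0}"
    proof cases
      case 1 then show ?thesis using l by (intro exI[of _ 0] exI[of _ 1]) auto
    next
      case 2 then show ?thesis using l by (intro exI[of _ 0] exI[of _ 2]) auto
    next
      case 3 then show ?thesis using l \<sigma> ne by (intro exI[of _ 1] exI[of _ 2]) (auto simp flip: One_nat_def)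
    qed
    then obtain i k where ik: "i \<noteq> k" "{i, k} \<subseteq> {j\<in>{..<3::nat}. l j a = 0}" by blast
    have "card {i, k} \<le> card {j\<in>{..<3::nat}. l j a = 0}"
      using ik(2) by (intro card_mono) auto
    then show "2 \<le> card {j\<in>{..<3::nat}. l j a = 0}" using ik(1) by simp
  next
    fix j assume "j \<in> {..<3::nat}"
    then have "j = 0 \<or> j = 1 \<or> j = 2" by auto
    then show "l j (z1, z2) \<noteq> 0"
      using z ds0 l[of "(z1, z2)"] by (auto simp flip: One_nat_def)
  qed (use z in auto)
  also have "(\<Sum>j<3. ln (norm (l j (z1, z2)))) / real 2 = (ln (norm z2) + ln (norm (z2 - \<delta> * z1) / (1 + norm \<delta>))
       + ln (norm (z2 - \<sigma> * (z1 - \<epsilon>)) / (1 + 2 * norm \<sigma>))) / 2"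
    unfolding J by (simp add: l norm_divide ds flip: One_nat_def)
  finally show ?thesis .
qed

text \<open>The disk is \<open>x \<mapsto> (A x + B p x, p x)\<close>. It passes through the first two poles at the zeros \<open>0\<close> and
  \<open>x2\<close> of \<open>p\<close>, through the third one at \<open>x3\<close>, and through \<open>(z1, z2)\<close> at \<open>x0\<close>.
  The conditions on \<open>M\<close> keep its part over \<open>|x| \<le> R\<close> inside the bidisk.\<close>

lemma pluricomplex_green_three_poles_le:
  fixes A B R x0 x2 x3 c d z1 z2 \<epsilon> \<rho> \<delta>
  defines "p \<equiv> \<lambda>x::complex. x * (x - x2) * (c + d * x)"
    and "M \<equiv> R * (R + norm x2) * (norm c + norm d * R)"
  assumes A: "A \<noteq> 0" and nz: "\<epsilon> \<noteq> 0" "\<rho> \<noteq> 0" "\<delta> \<noteq> 0"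
    and x2: "A * x2 = \<epsilon>" and x3: "A * x3 + B * (\<delta> * \<rho>) = \<rho>" "p x3 = \<delta> * \<rho>"
    and x0: "A * x0 + B * z2 = z1" "p x0 = z2" "z2 \<noteq> 0" "x0 \<noteq> x3"
    and R: "norm x2 < R" "norm x3 < R" "norm x0 < R"
    and M: "M < 1" "norm A * R + norm B * M < 1"
  shows "pluricomplex_green bidisk {(0, 0), (\<epsilon>, 0), (\<rho>, \<delta> * \<rho>)} (z1, z2)
     \<le> ereal (ln (norm x0 / R) + ln (norm (x0 - x2) / (R - norm x2)) + ln (norm (x0 - x3) / (R - norm x3)))"
  unfolding pluricomplex_green_def
proof (rule SUP_least)
  fix u assume u: "u \<in> {u \<in> psh_nonpos bidisk. \<forall>a\<in>{(0, 0), (\<epsilon>, 0), (\<rho>, \<delta> * \<rho>)}. log_pole_at a u}"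
  have R0: "R > 0" using R(3) norm_ge_zero[of x0] by linarith
  have px: "p 0 = 0" "p x2 = 0" by (auto simp: p_def)
  have d: "x2 \<noteq> 0" "x3 \<noteq> 0" "x3 \<noteq> x2" "x0 \<noteq> 0" "x0 \<noteq> x2"
    using x2 x3 x0 px nz by auto
  have pM: "norm (p x) \<le> M" if "norm x \<le> R" for x
  proof -
    have "norm (x - x2) \<le> R + norm x2" using that norm_triangle_ineq4[of x x2] by simp
    moreover have "norm (c + d * x) \<le> norm c + norm d * R"
      using that by (intro order_trans[OF norm_triangle_ineq] add_left_mono) (auto simp: norm_mult intro!: mult_left_mono)
    ultimately show ?thesis
      unfolding p_def M_def norm_mult using that R0 by (intro mult_mono) auto
  qed
  have "u (A * x0 + B * p x0, p x0) \<le> ereal (\<Sum>q\<in>{0, x2, x3}. ln (norm (x0 - q) / (R - norm q)))"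
  proof (rule psh_nonpos_log_poles_on_graph[where \<Omega> = bidisk])
    show "open bidisk" by (auto simp: bidisk_def intro!: open_Times)
    show "continuous_on (cball 0 R) p" "p holomorphic_on ball 0 R"
      unfolding p_def by (intro continuous_intros holomorphic_intros)+
    show "(A * x + B * p x, p x) \<in> bidisk" if "x \<in> cball 0 R" for x
    proof -
      have x: "norm x \<le> R" using that by simp
      have "norm (A * x + B * p x) \<le> norm A * R + norm B * M"
        using x pM[OF x] by (intro order_trans[OF norm_triangle_ineq] add_mono) (auto simp: norm_mult intro!: mult_left_mono)
      then show ?thesis using pM[OF x] M by (simp add: bidisk_def)
    qed
    show "log_pole_at (A * q + B * p q, p q) u" if "q \<in> {0, x2, x3}" for q
      using that u px x2 x3 by auto
  qed (use u A R R0 d x0 in auto)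
  then show "u (z1, z2) \<le> ereal (ln (norm x0 / R) + ln (norm (x0 - x2) / (R - norm x2)) + ln (norm (x0 - x3) / (R - norm x3)))"
    using x0 d by (simp add: add.assoc)
qed

text \<open>The slope \<open>\<sigma>\<close> of the third line tends to \<open>0\<close> because \<open>|\<rho>| \<le> 2 |\<rho> - \<epsilon>|\<close>.\<close>

lemma three_poles_green_liminf:
  fixes \<epsilon> \<delta> \<rho> :: "'i \<Rightarrow> complex"
  assumes lim: "(\<epsilon> \<longlongrightarrow> 0) F" "(\<delta> \<longlongrightarrow> 0) F"
    and ev: "\<forall>\<^sub>F i in F. \<epsilon> i \<noteq> \<rho> i \<and> norm (\<rho> i) \<le> 2 * norm (\<rho> i - \<epsilon> i)"
    and z: "(z1, z2) \<in> bidisk" "z2 \<noteq> 0"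
    and a: "a < ereal (3 / 2 * ln (norm z2))"
  shows "\<forall>\<^sub>F i in F. a < pluricomplex_green bidisk {(0, 0), (\<epsilon> i, 0), (\<rho> i, \<delta> i * \<rho> i)} (z1, z2)"
proof -
  define \<sigma> where "\<sigma> i = \<delta> i * \<rho> i / (\<rho> i - \<epsilon> i)" for i
  have "\<forall>\<^sub>F i in F. norm (\<sigma> i) \<le> 2 * norm (\<delta> i)"
    using ev
  proof eventually_elim
    case (elim i)
    have "norm (\<delta> i) * norm (\<rho> i) \<le> norm (\<delta> i) * (2 * norm (\<rho> i - \<epsilon> i))"
      using elim by (intro mult_left_mono) auto
    then show ?case using elim by (simp add: \<sigma>_def norm_divide norm_mult divide_le_eq mult_ac)
  qed
  moreover have "((\<lambda>i. 2 * norm (\<delta> i)) \<longlongrightarrow> 0) F" using lim(2) by (auto intro!: tendsto_eq_intros)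
  ultimately have \<sigma>: "(\<sigma> \<longlongrightarrow> 0) F" by (rule Lim_null_comparison)
  have l2: "((\<lambda>i. z2 - \<delta> i * z1) \<longlongrightarrow> z2) F" using lim(2) by (auto intro!: tendsto_eq_intros)
  have l3: "((\<lambda>i. z2 - \<sigma> i * (z1 - \<epsilon> i)) \<longlongrightarrow> z2) F" using \<sigma> lim(1) by (auto intro!: tendsto_eq_intros)
  have l2': "((\<lambda>i. norm (z2 - \<delta> i * z1) / (1 + norm (\<delta> i))) \<longlongrightarrow> norm z2) F"
    using l2 lim(2) by (auto intro!: tendsto_eq_intros)
  have l3': "((\<lambda>i. norm (z2 - \<sigma> i * (z1 - \<epsilon> i)) / (1 + 2 * norm (\<sigma> i))) \<longlongrightarrow> norm z2) F"
    using l3 \<sigma> lim(1) by (auto intro!: tendsto_eq_intros)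
  define f where "f i = (ln (norm z2) + ln (norm (z2 - \<delta> i * z1) / (1 + norm (\<delta> i)))
       + ln (norm (z2 - \<sigma> i * (z1 - \<epsilon> i)) / (1 + 2 * norm (\<sigma> i)))) / 2" for i
  have "(f \<longlongrightarrow> (ln (norm z2) + ln (norm z2) + ln (norm z2)) / 2) F"
    unfolding f_def using z(2) by (intro tendsto_intros l2' l3') auto
  then have "((\<lambda>i. ereal (f i)) \<longlongrightarrow> ereal (3 / 2 * ln (norm z2))) F"
    by (intro tendsto_ereal) simp
  then have "\<forall>\<^sub>F i in F. a < ereal (f i)" using a by (rule order_tendstoD)
  moreover have "\<forall>\<^sub>F i in F. z2 - \<delta> i * z1 \<noteq> 0" using tendsto_imp_eventually_ne[OF l2 z(2)] .
  moreover have "\<forall>\<^sub>F i in F. z2 - \<sigma> i * (z1 - \<epsilon> i) \<noteq> 0" using tendsto_imp_eventually_ne[OF l3 z(2)] .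
  moreover have "\<forall>\<^sub>F i in F. norm (\<epsilon> i) < 1"
    using order_tendstoD(2)[OF tendsto_norm[OF lim(1)], of 1] by simp
  ultimately show ?thesis using ev
  proof eventually_elim
    case (elim i)
    then have "ereal (f i) \<le> pluricomplex_green bidisk {(0, 0), (\<epsilon> i, 0), (\<rho> i, \<delta> i * \<rho> i)} (z1, z2)"
      unfolding f_def using z by (intro pluricomplex_green_three_poles_ge) (auto simp: \<sigma>_def)
    with elim(1) show ?case by (rule less_le_trans)
  qed
qed

text \<open>The parameters of the disk of \<open>pluricomplex_green_three_poles_le\<close> come from solving the interpolation
  conditions backwards. The choice \<open>x0\<^sup>2 = z2\<close> fixes the parameter of \<open>z\<close>. Given \<open>A\<close>, the conditions at
  \<open>z\<close> and at the poles determine \<open>B\<close>, \<open>x2\<close> and \<open>x3\<close>, and \<open>c + d x\<close> is the linear polynomial with the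
  values \<open>\<alpha>\<close> at \<open>x3\<close> and \<open>\<beta>\<close> at \<open>x0\<close> that make \<open>p\<close> interpolate. The choice \<open>A\<^sup>2 = (\<rho> - \<epsilon>) / \<delta>\<close> makes
  \<open>\<alpha>\<close> tend to \<open>1\<close>; as \<open>\<beta>\<close> does too, \<open>p x\<close> tends to \<open>x\<^sup>2\<close>. Moreover \<open>|A|\<^sup>2 \<le> |\<epsilon> / \<delta>|\<close> tends to \<open>0\<close>,
  whereas \<open>|x2|\<^sup>2\<close> and \<open>|x3|\<^sup>2\<close> are \<open>O(|\<epsilon> \<delta>|)\<close>.\<close>

lemma three_poles_green_limsup:
  fixes \<epsilon> \<delta> \<rho> :: "'i \<Rightarrow> complex"
  assumes lim: "(\<epsilon> \<longlongrightarrow> 0) F" "(\<delta> \<longlongrightarrow> 0) F" "filterlim (\<lambda>i. norm (\<delta> i / \<epsilon> i)) at_top F"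
    and ev: "\<forall>\<^sub>F i in F. \<epsilon> i \<noteq> 0 \<and> \<rho> i \<noteq> 0 \<and> norm (\<rho> i) \<le> 2 * norm (\<rho> i - \<epsilon> i) \<and> norm (\<epsilon> i) \<le> 3 * norm (\<rho> i - \<epsilon> i)
       \<and> norm (\<rho> i - \<epsilon> i) \<le> norm (\<epsilon> i)"
    and z: "(z1, z2) \<in> bidisk" "z2 \<noteq> 0" "norm z1 \<le> norm z2"
    and a: "ereal (3 / 2 * ln (norm z2)) < a"
  shows "\<forall>\<^sub>F i in F. pluricomplex_green bidisk {(0, 0), (\<epsilon> i, 0), (\<rho> i, \<delta> i * \<rho> i)} (z1, z2) < a"
proof -
  define x0 where "x0 = csqrt z2"
  have x0: "x0 * x0 = z2" "x0 \<noteq> 0" "norm x0 = sqrt (norm z2)" "norm x0 < 1"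
    using z by (auto simp: x0_def bidisk_def simp flip: power2_eq_square)
  define k where "k i = \<rho> i - \<epsilon> i" for i
  define A where "A i = csqrt (k i / \<delta> i)" for i
  define B where "B i = (z1 - A i * x0) / z2" for i
  define x2 where "x2 i = \<epsilon> i / A i" for i
  define y where "y i = \<rho> i / A i" for i
  define x3 where "x3 i = y i * (1 - B i * \<delta> i)" for i
  define \<alpha> where "\<alpha> i = 1 / ((1 - B i * \<delta> i) * (1 - B i * (\<delta> i * (\<rho> i / k i))))" for i
  define \<beta> where "\<beta> i = z2 / (x0 * (x0 - x2 i))" for i
  define d where "d i = (\<beta> i - \<alpha> i) / (x0 - x3 i)" for i
  define c where "c i = \<alpha> i - d i * x3 i" for i
  have "\<forall>\<^sub>F i in F. 1 \<le> norm (\<delta> i / \<epsilon> i)"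
    using lim(3) unfolding filterlim_at_top by blast
  with ev have ev': "\<forall>\<^sub>F i in F. \<epsilon> i \<noteq> 0 \<and> \<rho> i \<noteq> 0 \<and> \<delta> i \<noteq> 0 \<and> k i \<noteq> 0 \<and> A i \<noteq> 0 \<and> A i * A i = k i / \<delta> i \<and>
     norm (\<rho> i) \<le> 2 * norm (k i) \<and> norm (\<epsilon> i) \<le> 3 * norm (k i) \<and> norm (k i) \<le> norm (\<epsilon> i)"
  proof eventually_elim
    case (elim i)
    then have "\<delta> i \<noteq> 0" "k i \<noteq> 0" by (auto simp: k_def)
    then show ?case using elim by (auto simp: A_def k_def simp flip: power2_eq_square)
  qed
  have null: "(f \<longlongrightarrow> 0) F" if g: "(g \<longlongrightarrow> 0) F" and le: "\<forall>\<^sub>F i in F. (norm (f i))\<^sup>2 \<le> g i"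
    for f :: "'i \<Rightarrow> complex" and g :: "'i \<Rightarrow> real"
  proof (rule Lim_null_comparison)
    show "\<forall>\<^sub>F i in F. norm (f i) \<le> sqrt (g i)"
      using le by eventually_elim (simp add: real_le_rsqrt)
    show "((\<lambda>i. sqrt (g i)) \<longlongrightarrow> 0) F" using tendsto_real_sqrt[OF g] by simp
  qed
  have A: "(A \<longlongrightarrow> 0) F"
  proof (rule null)
    show "((\<lambda>i. inverse (norm (\<delta> i / \<epsilon> i))) \<longlongrightarrow> 0) F"
      by (rule tendsto_inverse_0_at_top[OF lim(3)])
    show "\<forall>\<^sub>F i in F. (norm (A i))\<^sup>2 \<le> inverse (norm (\<delta> i / \<epsilon> i))"
      using ev'
    proof eventually_elim
      case (elim i)
      have "(norm (A i))\<^sup>2 = norm (A i * A i)" by (simp add: norm_mult power2_eq_square)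
      then show ?case using elim by (simp add: norm_divide divide_right_mono)
    qed
  qed
  have ed: "((\<lambda>i. C * (norm (\<epsilon> i) * norm (\<delta> i))) \<longlongrightarrow> 0) F" for C :: real
    using lim by (auto intro!: tendsto_eq_intros)
  have quot: "(norm (w / A i))\<^sup>2 = (norm w)\<^sup>2 * norm (\<delta> i) / norm (k i)"
    if "A i * A i = k i / \<delta> i" for w i
  proof -
    have "(norm (w / A i))\<^sup>2 = (norm w)\<^sup>2 / norm (A i * A i)"
      by (simp add: norm_divide power_divide norm_mult power2_eq_square)
    then show ?thesis using that by (simp add: norm_divide)
  qed
  have x2: "(x2 \<longlongrightarrow> 0) F"
  proof (rule null[OF ed[of 3]])
    show "\<forall>\<^sub>F i in F. (norm (x2 i))\<^sup>2 \<le> 3 * (norm (\<epsilon> i) * norm (\<delta> i))"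
      using ev'
    proof eventually_elim
      case (elim i)
      have "norm (\<epsilon> i) * (norm (\<epsilon> i) * norm (\<delta> i)) \<le> 3 * norm (k i) * (norm (\<epsilon> i) * norm (\<delta> i))"
        using elim by (intro mult_right_mono) auto
      moreover have "A i * A i = k i / \<delta> i" using elim by simp
      ultimately show ?case using elim unfolding x2_def
        by (simp only: quot) (simp add: divide_le_eq power2_eq_square mult_ac)
    qed
  qed
  have y: "(y \<longlongrightarrow> 0) F"
  proof (rule null[OF ed[of 4]])
    show "\<forall>\<^sub>F i in F. (norm (y i))\<^sup>2 \<le> 4 * (norm (\<epsilon> i) * norm (\<delta> i))"
      using ev'
    proof eventually_elim
      case (elim i)
      have "norm (\<rho> i) * norm (\<rho> i) \<le> (2 * norm (k i)) * (2 * norm (\<epsilon> i))"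
        using elim by (intro mult_mono) auto
      then have "norm (\<rho> i) * norm (\<rho> i) * norm (\<delta> i) \<le> (2 * norm (k i)) * (2 * norm (\<epsilon> i)) * norm (\<delta> i)"
        by (rule mult_right_mono) simp
      moreover have "A i * A i = k i / \<delta> i" using elim by simp
      ultimately show ?case using elim unfolding y_def
        by (simp only: quot) (simp add: divide_le_eq power2_eq_square mult_ac)
    qed
  qed
  have B: "(B \<longlongrightarrow> z1 / z2) F" unfolding B_def using A z by (auto intro!: tendsto_eq_intros)
  have x3: "(x3 \<longlongrightarrow> 0) F" unfolding x3_def using y B lim(2) by (auto intro!: tendsto_eq_intros)
  have dr: "((\<lambda>i. \<delta> i * (\<rho> i / k i)) \<longlongrightarrow> 0) F"
  proof (rule Lim_null_comparison)
    show "((\<lambda>i. 2 * norm (\<delta> i)) \<longlongrightarrow> 0) F" using lim(2) by (auto intro!: tendsto_eq_intros)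
    show "\<forall>\<^sub>F i in F. norm (\<delta> i * (\<rho> i / k i)) \<le> 2 * norm (\<delta> i)"
      using ev'
    proof eventually_elim
      case (elim i)
      have "norm (\<delta> i) * norm (\<rho> i) \<le> norm (\<delta> i) * (2 * norm (k i))"
        using elim by (intro mult_left_mono) auto
      then show ?case using elim by (simp add: norm_divide norm_mult divide_le_eq mult_ac)
    qed
  qed
  have e1: "((\<lambda>i. 1 - B i * \<delta> i) \<longlongrightarrow> 1) F" using B lim(2) by (auto intro!: tendsto_eq_intros)
  have e2: "((\<lambda>i. 1 - B i * (\<delta> i * (\<rho> i / k i))) \<longlongrightarrow> 1) F"
    using tendsto_diff[OF tendsto_const tendsto_mult[OF B dr], of 1] by simp
  have \<alpha>: "(\<alpha> \<longlongrightarrow> 1) F" 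
    using tendsto_divide[OF tendsto_const tendsto_mult[OF e1 e2], of 1] by (simp add: \<alpha>_def[abs_def])
  have \<beta>: "(\<beta> \<longlongrightarrow> 1) F" unfolding \<beta>_def using x2 x0 z(2) by (auto intro!: tendsto_eq_intros)
  have d: "(d \<longlongrightarrow> 0) F" unfolding d_def using \<alpha> \<beta> x3 x0 by (auto intro!: tendsto_eq_intros)
  have c: "(c \<longlongrightarrow> 1) F" unfolding c_def using \<alpha> d x3 by (auto intro!: tendsto_eq_intros)
  \<comment> \<open>For a fixed radius \<open>R < 1\<close> the disk eventually lies in the bidisk, and the bound that it gives
    tends to \<open>3 ln (|x0| / R)\<close>.\<close>
  obtain R where R: "norm x0 < R" "R < 1" "ereal (3 * ln (norm x0 / R)) < a"
  proof -
    have "((\<lambda>R. ereal (3 * ln (norm x0 / R))) \<longlongrightarrow> ereal (3 * ln (norm x0 / 1))) (at_left 1)"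
      using x0 by (intro tendsto_intros) auto
    moreover have "ereal (3 * ln (norm x0 / 1)) < a" using a x0(3) z(2) by (simp add: ln_sqrt)
    ultimately have "\<forall>\<^sub>F R in at_left 1. ereal (3 * ln (norm x0 / R)) < a" by (rule order_tendstoD)
    moreover have "\<forall>\<^sub>F R in at_left 1. R \<in> {norm x0<..<1}" by (rule eventually_at_left_real[OF x0(4)])
    ultimately have "\<forall>\<^sub>F R in at_left 1. norm x0 < R \<and> R < 1 \<and> ereal (3 * ln (norm x0 / R)) < a"
      by eventually_elim auto
    then have "\<exists>R. norm x0 < R \<and> R < 1 \<and> ereal (3 * ln (norm x0 / R)) < a"
      by (rule eventually_happens'[rotated]) simp
    then show ?thesis using that by blast
  qed
  have R0: "R > 0" using R(1) norm_ge_zero[of x0] by linarith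
  define h where "h i = ln (norm x0 / R) + ln (norm (x0 - x2 i) / (R - norm (x2 i))) + ln (norm (x0 - x3 i) / (R - norm (x3 i)))" for i
  have part: "((\<lambda>i. ln (norm (x0 - x i) / (R - norm (x i)))) \<longlongrightarrow> ln (norm x0 / R)) F" if "(x \<longlongrightarrow> 0) F" for x
    using that x0 R0 z(2) by (auto intro!: tendsto_eq_intros)
  have "(h \<longlongrightarrow> ln (norm x0 / R) + ln (norm x0 / R) + ln (norm x0 / R)) F"
    unfolding h_def by (intro tendsto_intros part x2 x3)
  then have "((\<lambda>i. ereal (h i)) \<longlongrightarrow> ereal (3 * ln (norm x0 / R))) F"
    by (intro tendsto_ereal) simp
  then have ha: "\<forall>\<^sub>F i in F. ereal (h i) < a" using R(3) by (rule order_tendstoD)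
  define M where "M i = R * (R + norm (x2 i)) * (norm (c i) + norm (d i) * R)" for i
  have M: "(M \<longlongrightarrow> R * R) F" unfolding M_def using x2 c d by (auto intro!: tendsto_eq_intros)
  have RR: "R * R < 1" using R R0 mult_strict_mono[of R 1 R 1] by simp
  have N: "((\<lambda>i. norm (A i) * R + norm (B i) * M i) \<longlongrightarrow> norm (z1 / z2) * (R * R)) F"
    using A B M by (auto intro!: tendsto_eq_intros)
  have "norm (z1 / z2) * (R * R) \<le> 1 * (R * R)"
    using z R0 by (intro mult_right_mono) (auto simp: norm_divide divide_le_eq_1)
  then have NN: "norm (z1 / z2) * (R * R) < 1" using RR by simp
  have small: "\<forall>\<^sub>F i in F. norm (x i) < r" if "(x \<longlongrightarrow> 0) F" "r > 0" for x :: "'i \<Rightarrow> complex" and r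
    using order_tendstoD(2)[OF tendsto_norm[OF that(1)], of r] that(2) by simp
  have "norm x0 > 0" using x0(2) by simp
  from small[OF x2 R0] small[OF x3 R0] small[OF x2 this] small[OF x3 this] ha ev'
    order_tendstoD(2)[OF M RR] order_tendstoD(2)[OF N NN]
    tendsto_imp_eventually_ne[OF e1 one_neq_zero] tendsto_imp_eventually_ne[OF e2 one_neq_zero]
  show ?thesis
  proof eventually_elim
    case (elim i)
    have ne: "x0 \<noteq> x2 i" "x0 \<noteq> x3 i" using elim(3,4) by auto
    have "pluricomplex_green bidisk {(0, 0), (\<epsilon> i, 0), (\<rho> i, \<delta> i * \<rho> i)} (z1, z2) \<le> ereal (h i)"
      unfolding h_def
    proof (rule pluricomplex_green_three_poles_le[where A = "A i" and B = "B i" and c = "c i" and d = "d i"])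
      show "A i * x2 i = \<epsilon> i" using elim by (simp add: x2_def)
      show "A i * x3 i + B i * (\<delta> i * \<rho> i) = \<rho> i"
        using elim by (simp add: x3_def y_def algebra_simps)
      show "A i * x0 + B i * z2 = z1" using z by (simp add: B_def)
      show "x0 * (x0 - x2 i) * (c i + d i * x0) = z2"
      proof -
        have "c i + d i * x0 = \<alpha> i + d i * (x0 - x3 i)" by (simp add: c_def algebra_simps)
        also have "\<dots> = \<beta> i" using ne by (simp add: d_def)
        finally show ?thesis using ne x0 by (simp add: \<beta>_def)
      qed
      show "x3 i * (x3 i - x2 i) * (c i + d i * x3 i) = \<delta> i * \<rho> i"
      proof -
        define s where "s = 1 - B i * (\<delta> i * (\<rho> i / k i))"
        have s: "s \<noteq> 0" "1 - B i * \<delta> i \<noteq> 0" using elim by (auto simp: s_def)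
        \<comment> \<open>The factor \<open>\<alpha>\<close> is \<open>\<delta> \<rho> / (x3 (x3 - x2))\<close>, written without \<open>A\<close>.\<close>
        have "A i * (x3 i - x2 i) = \<rho> i * (1 - B i * \<delta> i) - \<epsilon> i"
          using elim by (simp add: x3_def x2_def y_def algebra_simps)
        also have "\<dots> = k i * s"
          using elim by (simp add: s_def k_def field_simps)
        finally have 1: "A i * (x3 i - x2 i) = k i * s" .
        have 2: "A i * x3 i = \<rho> i * (1 - B i * \<delta> i)" using elim by (simp add: x3_def y_def)
        have sq: "k i / \<delta> i = A i * A i" using elim by simp
        have "(k i / \<delta> i) * (x3 i * (x3 i - x2 i)) = (A i * x3 i) * (A i * (x3 i - x2 i))"
          unfolding sq by (simp only: mult_ac)
        also have "\<dots> = k i * (\<rho> i * (1 - B i * \<delta> i) * s)" unfolding 1 2 by (simp only: mult_ac)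
        finally have "(k i / \<delta> i) * (x3 i * (x3 i - x2 i)) = k i * (\<rho> i * (1 - B i * \<delta> i) * s)" .
        moreover have "a = d * b" if "(k / d) * a = k * b" "k \<noteq> 0" "d \<noteq> 0" for a b d k :: complex
          using that by (simp add: field_simps)
        ultimately have "x3 i * (x3 i - x2 i) = \<delta> i * (\<rho> i * (1 - B i * \<delta> i) * s)"
          using elim by blast
        then have "x3 i * (x3 i - x2 i) = \<delta> i * \<rho> i * ((1 - B i * \<delta> i) * s)"
          by (simp only: mult_ac)
        moreover have "c i + d i * x3 i = 1 / ((1 - B i * \<delta> i) * s)" by (simp add: c_def \<alpha>_def s_def)
        ultimately show ?thesis using s by simp
      qed
    qed (use elim z R ne in \<open>auto simp: M_def\<close>)
    then show ?case using elim(5) by (rule le_less_trans)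
  qed
qed

theorem corollary1p8:
  fixes E :: "complex set"
    and \<rho> \<delta> :: "complex \<Rightarrow> complex"
    and a1 a2 a3 :: "complex \<Rightarrow> complex \<times> complex"
    and S :: "complex \<Rightarrow> (complex \<times> complex) set"
    and G :: "complex \<Rightarrow> complex \<times> complex \<Rightarrow> ereal"
    and z1 z2 :: complex
  assumes "E \<subseteq> - {0}" and "0 \<in> closure E"
    and "\<And>\<epsilon>. \<epsilon> \<in> E \<Longrightarrow> a1 \<epsilon> = (0, 0)"
    and "\<And>\<epsilon>. \<epsilon> \<in> E \<Longrightarrow> a2 \<epsilon> = (\<epsilon>, 0)"
    and "\<And>\<epsilon>. \<epsilon> \<in> E \<Longrightarrow> a3 \<epsilon> = (\<rho> \<epsilon>, \<delta> \<epsilon> * \<rho> \<epsilon>)"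
    and "\<And>\<epsilon>. \<epsilon> \<in> E \<Longrightarrow> \<rho> \<epsilon> \<noteq> 0"
    and "\<And>\<epsilon>. \<epsilon> \<in> E \<Longrightarrow> S \<epsilon> = {a1 \<epsilon>, a2 \<epsilon>, a3 \<epsilon>}"
    and "\<And>\<epsilon>. \<epsilon> \<in> E \<Longrightarrow> S \<epsilon> \<subseteq> bidisk"
    and "\<And>\<epsilon>. \<epsilon> \<in> E \<Longrightarrow> distinct [a1 \<epsilon>, a2 \<epsilon>, a3 \<epsilon>]"
    and "\<And>\<epsilon>. \<epsilon> \<in> E \<Longrightarrow> norm (a3 \<epsilon>) \<le> norm (a3 \<epsilon> - a2 \<epsilon>)"
    and "\<And>\<epsilon>. \<epsilon> \<in> E \<Longrightarrow> norm (a3 \<epsilon> - a2 \<epsilon>) \<le> norm \<epsilon>"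
    and "(\<delta> \<longlongrightarrow> 0) (at 0 within E)"
    and "filterlim (\<lambda>\<epsilon>. norm (\<delta> \<epsilon> / \<epsilon>)) at_top (at 0 within E)"
    and "\<And>\<epsilon>. \<epsilon> \<in> E \<Longrightarrow> G \<epsilon> = pluricomplex_green bidisk (S \<epsilon>)"
    and "((\<lambda>\<epsilon>. ln (norm (\<delta> \<epsilon>)) / ln (norm \<epsilon>)) \<longlongrightarrow> 0) (at 0 within E)"
    and "(z1, z2) \<in> bidisk - {(0, 0)}"
    and "norm z2 \<ge> norm z1"
  shows "((\<lambda>\<epsilon>. G \<epsilon> (z1, z2)) \<longlongrightarrow> ereal (3 / 2 * ln (norm z2))) (at 0 within E)"
proof -
  let ?F = "at (0::complex) within E"
  have z: "(z1, z2) \<in> bidisk" "z2 \<noteq> 0" using assms(16,17) by auto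
  \<comment> \<open>With \<open>|\<delta>| < 1/2\<close>, the distance conditions on the poles make \<open>|\<rho> - \<epsilon>|\<close> comparable to \<open>|\<epsilon>|\<close>
    and bound \<open>|\<rho>|\<close> by twice its value.\<close>
  have "\<forall>\<^sub>F \<epsilon> in ?F. norm (\<delta> \<epsilon>) < 1 / 2"
    using order_tendstoD(2)[OF tendsto_norm[OF assms(12)], of "1 / 2"] by simp
  moreover have inE: "\<forall>\<^sub>F \<epsilon> in ?F. \<epsilon> \<in> E" by (simp add: eventually_at_filter)
  ultimately have ev: "\<forall>\<^sub>F \<epsilon> in ?F. \<epsilon> \<noteq> 0 \<and> \<rho> \<epsilon> \<noteq> 0 \<and> norm (\<rho> \<epsilon>) \<le> 2 * norm (\<rho> \<epsilon> - \<epsilon>)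
      \<and> norm \<epsilon> \<le> 3 * norm (\<rho> \<epsilon> - \<epsilon>) \<and> norm (\<rho> \<epsilon> - \<epsilon>) \<le> norm \<epsilon>"
  proof eventually_elim
    case (elim \<epsilon>)
    note E = elim(2)
    have diff: "a3 \<epsilon> - a2 \<epsilon> = (\<rho> \<epsilon> - \<epsilon>, \<delta> \<epsilon> * \<rho> \<epsilon>)" using assms(4,5)[OF E] by simp
    have "norm (\<rho> \<epsilon>) \<le> norm (a3 \<epsilon>)" using assms(5)[OF E] norm_fst_le by metis
    also have "\<dots> \<le> norm (\<rho> \<epsilon> - \<epsilon>, \<delta> \<epsilon> * \<rho> \<epsilon>)" using assms(10)[OF E] diff by simp
    also have "\<dots> \<le> norm (\<rho> \<epsilon> - \<epsilon>) + norm (\<delta> \<epsilon> * \<rho> \<epsilon>)" by (rule norm_Pair_le)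
    also have "norm (\<delta> \<epsilon> * \<rho> \<epsilon>) \<le> 1 / 2 * norm (\<rho> \<epsilon>)"
      unfolding norm_mult using elim(1) by (intro mult_right_mono) auto
    finally have 1: "norm (\<rho> \<epsilon>) \<le> 2 * norm (\<rho> \<epsilon> - \<epsilon>)" by simp
    have 2: "norm \<epsilon> \<le> norm (\<rho> \<epsilon>) + norm (\<rho> \<epsilon> - \<epsilon>)" using norm_triangle_ineq4[of "\<rho> \<epsilon>" "\<rho> \<epsilon> - \<epsilon>"] by simp
    have "norm (\<rho> \<epsilon> - \<epsilon>) \<le> norm (a3 \<epsilon> - a2 \<epsilon>)" unfolding diff by (rule norm_fst_le)
    also have "\<dots> \<le> norm \<epsilon>" using assms(11)[OF E] .
    finally show ?case using 1 2 assms(1,6) E by auto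
  qed
  have green: "\<forall>\<^sub>F \<epsilon> in ?F. pluricomplex_green bidisk {(0, 0), (\<epsilon>, 0), (\<rho> \<epsilon>, \<delta> \<epsilon> * \<rho> \<epsilon>)} (z1, z2) = G \<epsilon> (z1, z2)"
    using inE by eventually_elim (simp add: assms(3,4,5,7,14))
  have id: "((\<lambda>\<epsilon>. \<epsilon>) \<longlongrightarrow> 0) ?F" by (rule tendsto_ident_at)
  show ?thesis
  proof (rule order_tendstoI)
    fix a assume a: "a < ereal (3 / 2 * ln (norm z2))"
    have "\<forall>\<^sub>F \<epsilon> in ?F. \<epsilon> \<noteq> \<rho> \<epsilon> \<and> norm (\<rho> \<epsilon>) \<le> 2 * norm (\<rho> \<epsilon> - \<epsilon>)"
      using ev by eventually_elim auto
    from three_poles_green_liminf[OF id assms(12) this z a] green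
    show "\<forall>\<^sub>F \<epsilon> in ?F. a < G \<epsilon> (z1, z2)" by eventually_elim simp
  next
    fix a assume a: "ereal (3 / 2 * ln (norm z2)) < a"
    from three_poles_green_limsup[OF id assms(12,13) ev z assms(17) a] green
    show "\<forall>\<^sub>F \<epsilon> in ?F. G \<epsilon> (z1, z2) < a" by eventually_elim simp
  qed
qed

end
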